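(* There exists an essential, natural uniform algebra on the unit sphere $S$ in $\mathbb C^3$ that contains the ball algebra $A(S)$ and is invariant under the action of the $3$-torus on $S$.
   Context: For a compact Hausdorff space $X$, $C(X)$ is the algebra of all continuous complex-valued functions on $X$ with the supremum norm. A uniform algebra on $X$ is a closed subalgebra of $C(X)$ that contains the constant functions and separates the points of $X$. Let $A$ be a uniform algebra on $X$. The essential set for $A$ is the smallest closed subset $E$ of $X$ such that $A$ contains every continuous function on $X$ that vanishes on $E$; $A$ is essential if its essential set is $X$. $A$ is natural (on $X$) if the only non-zero multiplicative linear functionals on $A$ are the evaluations at the points of $X$. The unit sphere is $S=\{(z_1,z_2,z_3)\in\mathbb C^3: |z_1|^2+|z_2|^2+|z_3|^2=1\}$. The ball algebra $A(S)$ consists of the restrictions to $S$ of the functions that are continuous on the closed unit ball of $\mathbb C^3$ and holomorphic on the open unit ball. The action of the $3$-torus $T^3$ on $S$ is the map $T^3\times S\to S$ given by $\bigl((e^{i\theta_1},e^{i\theta_2},e^{i\theta_3}),(z_1,z_2,z_3)\bigr)\mapsto (e^{i\theta_1}z_1,e^{i\theta_2}z_2,e^{i\theta_3}z_3)$. An algebra $A$ of functions on $S$ is invariant under the action of the $3$-torus if, whenever $f\in A$, the function $(z_1,z_2,z_3)\mapsto f(e^{i\theta_1}z_1,e^{i\theta_2}z_2,e^{i\theta_3}z_3)$ is in $A$ for each $(e^{i\theta_1},e^{i\theta_2},e^{i\theta_3})\in T^3$. *)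

theory Defs
  imports "HOL-Analysis.Analysis"
begin

(* A function on a space X is represented by its extensional representative,
   taking the value undefined off X, so that two functions that agree on X are
   equal. Pointwise operations are therefore followed by restriction to X. *)

definition cont_funs :: "'a::t2_space set \<Rightarrow> ('a \<Rightarrow> complex) set" where
  "cont_funs X = {f \<in> extensional X. continuous_on X f}"

(* The clause with uniform_limit is closedness in the supremum norm: uniform
   convergence on X is convergence in the norm of C(X). *)
definition uniform_algebra :: "'a::t2_space set \<Rightarrow> ('a \<Rightarrow> complex) set \<Rightarrow> bool" where
  "uniform_algebra X A \<longleftrightarrow>
     compact X \<and>
     A \<subseteq> cont_funs X \<and>
     (\<forall>f\<in>A. \<forall>g\<in>A. (\<lambda>x\<in>X. f x + g x) \<in> A) \<and>
     (\<forall>f\<in>A. \<forall>g\<in>A. (\<lambda>x\<in>X. f x * g x) \<in> A) \<and>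
     (\<forall>f\<in>A. \<forall>c. (\<lambda>x\<in>X. c * f x) \<in> A) \<and>
     (\<forall>g. \<forall>f\<in>cont_funs X.
        (\<forall>n. g n \<in> A) \<and> uniform_limit X g f sequentially \<longrightarrow> f \<in> A) \<and>
     (\<forall>c. (\<lambda>x\<in>X. c) \<in> A) \<and>
     (\<forall>x\<in>X. \<forall>y\<in>X. x \<noteq> y \<longrightarrow> (\<exists>f\<in>A. f x \<noteq> f y))"

definition contains_vanishing ::
  "'a::t2_space set \<Rightarrow> ('a \<Rightarrow> complex) set \<Rightarrow> 'a set \<Rightarrow> bool" where
  "contains_vanishing X A E \<longleftrightarrow> (\<forall>f\<in>cont_funs X. (\<forall>x\<in>E. f x = 0) \<longrightarrow> f \<in> A)"

definition is_essential_set ::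
  "'a::t2_space set \<Rightarrow> ('a \<Rightarrow> complex) set \<Rightarrow> 'a set \<Rightarrow> bool" where
  "is_essential_set X A E \<longleftrightarrow>
     closedin (top_of_set X) E \<and> contains_vanishing X A E \<and>
     (\<forall>F. closedin (top_of_set X) F \<and> contains_vanishing X A F \<longrightarrow> E \<subseteq> F)"

definition essential :: "'a::t2_space set \<Rightarrow> ('a \<Rightarrow> complex) set \<Rightarrow> bool" where
  "essential X A \<longleftrightarrow> is_essential_set X A X"

(* Only the values of phi on A matter. *)
definition mult_lin_functional ::
  "'a set \<Rightarrow> ('a \<Rightarrow> complex) set \<Rightarrow> (('a \<Rightarrow> complex) \<Rightarrow> complex) \<Rightarrow> bool" where
  "mult_lin_functional X A \<phi> \<longleftrightarrow>
     (\<forall>f\<in>A. \<forall>g\<in>A. \<phi> (\<lambda>x\<in>X. f x + g x) = \<phi> f + \<phi> g) \<and>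
     (\<forall>f\<in>A. \<forall>c. \<phi> (\<lambda>x\<in>X. c * f x) = c * \<phi> f) \<and>
     (\<forall>f\<in>A. \<forall>g\<in>A. \<phi> (\<lambda>x\<in>X. f x * g x) = \<phi> f * \<phi> g)"

definition natural :: "'a set \<Rightarrow> ('a \<Rightarrow> complex) set \<Rightarrow> bool" where
  "natural X A \<longleftrightarrow>
     (\<forall>\<phi>. mult_lin_functional X A \<phi> \<and> (\<exists>f\<in>A. \<phi> f \<noteq> 0)
        \<longrightarrow> (\<exists>x\<in>X. \<forall>f\<in>A. \<phi> f = f x))"

abbreviation unit_sphere3 :: "(complex^3) set" where
  "unit_sphere3 \<equiv> sphere 0 1"

lemma unit_sphere3_eq:
  "unit_sphere3 = {z. (cmod (z$1))\<^sup>2 + (cmod (z$2))\<^sup>2 + (cmod (z$3))\<^sup>2 = 1}"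
  by (auto simp: norm_vec_def L2_set_def sum_3)

(* Holomorphy in several variables: Frechet differentiability with a
   complex-linear derivative (has_derivative only gives real linearity). *)
definition holomorphic_on3 :: "(complex^3 \<Rightarrow> complex) \<Rightarrow> (complex^3) set \<Rightarrow> bool" where
  "holomorphic_on3 f U \<longleftrightarrow>
     (\<forall>z\<in>U. \<exists>D. (f has_derivative D) (at z) \<and> (\<forall>c v. D (c *s v) = c * D v))"

definition ball_algebra3 :: "(complex^3 \<Rightarrow> complex) set" where
  "ball_algebra3 =
     {restrict F unit_sphere3 | F. continuous_on (cball 0 1) F \<and> holomorphic_on3 F (ball 0 1)}"

definition torus_act :: "real^3 \<Rightarrow> complex^3 \<Rightarrow> complex^3" where
  "torus_act \<theta> z = (\<chi> j. cis (\<theta>$j) * z$j)"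

definition torus_invariant :: "(complex^3 \<Rightarrow> complex) set \<Rightarrow> bool" where
  "torus_invariant A \<longleftrightarrow> (\<forall>f\<in>A. \<forall>\<theta>. (\<lambda>z\<in>unit_sphere3. f (torus_act \<theta> z)) \<in> A)"

end

theory Submission
  imports Defs "HOL-Complex_Analysis.Complex_Analysis"
begin

text \<open>
  The map \<open>w z = |z\<^sub>1|\<^sup>2 + \<i> |z\<^sub>2|\<^sup>2\<close> sends the sphere onto a triangle, and its fibres are the torus orbits.
  In the open triangle choose disjoint Swiss cheeses \<open>Q\<^sub>n\<close> with diameters tending to 0, every nonempty open
  subset of the triangle containing one of them. The algebra consists of the continuous functions whose
  restriction to the part of the sphere over each \<open>Q\<^sub>n\<close> is a uniform limit of sums of
  \<open>F z * f (w z) / (z\<^sub>1^a * z\<^sub>2^b * z\<^sub>3^c)\<close>, where \<open>F\<close> comes from the ball algebra and \<open>f\<close> is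
  holomorphic off finitely many points outside \<open>Q\<^sub>n\<close>.

  It is essential because averaging over the torus turns such a sum into a holomorphic function of \<open>w\<close>,
  and these are not dense in the continuous functions on \<open>Q\<^sub>n\<close>.

  For naturality, let \<open>\<phi>\<close> be a character. Functions of \<open>w\<close> that are constant on every \<open>Q\<^sub>n\<close> belong to the
  algebra and localise \<open>\<phi>\<close> to one \<open>Q\<^sub>n\<close> or to one point, which contains \<open>s = \<phi> w\<close>. The cheeses carry
  no nontrivial Jensen measures, in the elementary form that there are \<open>f\<close> with \<open>f s = 1\<close> and \<open>|f|\<close>
  below the \<open>k\<close>-th power of any prescribed positive continuous function that exceeds 1 at \<open>s\<close>. Evaluating
  \<open>\<phi>\<close> on \<open>f (w z) / z\<^sub>j^k\<close>, cut off near \<open>Q\<^sub>n\<close>, gives \<open>|\<phi> z\<^sub>j| \<ge> |z\<^sub>j|\<close> over \<open>s\<close>, so that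
  \<open>(\<phi> z\<^sub>1, \<phi> z\<^sub>2, \<phi> z\<^sub>3)\<close> lies on the sphere. Every point of the sphere is a peak point of the ball
  algebra, hence \<open>\<phi>\<close> is the evaluation there.
\<close>

section \<open>Approximation on Swiss cheeses\<close>

text \<open>A stand-in for the rational functions with poles off \<open>K\<close>. Finitely many
  singularities are what the residue theorem asks for.\<close>

definition hol_off :: "complex set \<Rightarrow> (complex \<Rightarrow> complex) \<Rightarrow> bool" where
  "hol_off K f \<longleftrightarrow> (\<exists>pts. finite pts \<and> pts \<inter> K = {} \<and> f holomorphic_on - pts)"

lemma hol_offI: "\<lbrakk>f holomorphic_on - pts; finite pts; pts \<inter> K = {}\<rbrakk> \<Longrightarrow> hol_off K f"
  by (auto simp: hol_off_def)

lemma hol_off_const: "hol_off K (\<lambda>w. c)"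
  by (rule hol_offI[where pts="{}"]) auto

lemma hol_off_add:
  assumes "hol_off K f" "hol_off K g"
  shows "hol_off K (\<lambda>w. f w + g w)"
proof -
  obtain P R where P: "finite P" "P \<inter> K = {}" "f holomorphic_on - P"
    and R: "finite R" "R \<inter> K = {}" "g holomorphic_on - R"
    using assms by (auto simp: hol_off_def)
  have "f holomorphic_on -(P \<union> R)" "g holomorphic_on -(P \<union> R)"
    using P R by (auto elim: holomorphic_on_subset)
  then have "(\<lambda>w. f w + g w) holomorphic_on -(P \<union> R)"
    by (intro holomorphic_intros)
  then show ?thesis using P R by (intro hol_offI[where pts="P \<union> R"]) auto
qed

lemma hol_off_mult:
  assumes "hol_off K f" "hol_off K g"
  shows "hol_off K (\<lambda>w. f w * g w)"
proof -
  obtain P R where P: "finite P" "P \<inter> K = {}" "f holomorphic_on - P"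
    and R: "finite R" "R \<inter> K = {}" "g holomorphic_on - R"
    using assms by (auto simp: hol_off_def)
  have "f holomorphic_on -(P \<union> R)" "g holomorphic_on -(P \<union> R)"
    using P R by (auto elim: holomorphic_on_subset)
  then have "(\<lambda>w. f w * g w) holomorphic_on -(P \<union> R)"
    by (intro holomorphic_intros)
  then show ?thesis using P R by (intro hol_offI[where pts="P \<union> R"]) auto
qed

section \<open>Families of discs, and functions on their complement\<close>

lemma two_discs_in_disc:
  fixes p q :: complex
  assumes "r > 0" "s > 0" "cball p r \<inter> cball q s \<noteq> {}"
  shows "\<exists>c. cball p r \<subseteq> cball c (r + s) \<and> cball q s \<subseteq> cball c (r + s)"
proof -
  obtain x where "dist p x \<le> r" "dist q x \<le> s" using assms(3) by auto
  then have d: "dist p q \<le> r + s"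
    using dist_triangle2[of p q x] by linarith
  \<comment> \<open>The point dividing the segment from \<open>p\<close> to \<open>q\<close> in the
    ratio \<open>s : r\<close>. As the centres are at most \<open>r + s\<close> apart, it is within
    \<open>s\<close> of \<open>p\<close> and within \<open>r\<close> of \<open>q\<close>.\<close>
  define c where "c = p + (s / (r + s)) *\<^sub>R (q - p)"
  have "dist p c = (s / (r + s)) * dist p q"
    using assms by (simp add: c_def dist_norm norm_minus_commute abs_mult)
  also have "\<dots> \<le> (s / (r + s)) * (r + s)"
    using d assms by (intro mult_left_mono) auto
  finally have pc: "dist p c \<le> s" using assms by simp
  have "q - c = (r / (r + s)) *\<^sub>R (q - p)"
  proof -
    have "1 - s / (r + s) = r / (r + s)" using assms by (simp add: field_simps)
    moreover have "q - c = (1 - s / (r + s)) *\<^sub>R (q - p)"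
      by (simp add: c_def scaleR_diff_left)
    ultimately show ?thesis by simp
  qed
  then have "dist q c = (r / (r + s)) * dist p q"
    using assms by (simp add: dist_norm norm_minus_commute abs_mult)
  also have "\<dots> \<le> (r / (r + s)) * (r + s)"
    using d assms by (intro mult_left_mono) auto
  finally have qc: "dist q c \<le> r" using assms by simp
  have "cball p r \<subseteq> cball c (r + s)" "cball q s \<subseteq> cball c (r + s)"
    using pc qc by (simp_all add: cball_subset_cball_iff dist_commute)
  then show ?thesis by blast
qed

abbreviation "cdisc x \<equiv> cball (fst x) (snd x)"
abbreviation "odisc x \<equiv> ball (fst x) (snd x)"

text \<open>Discs that meet are merged in pairs, which never increases the sum of the radii.\<close>

lemma disjoint_disc_cover:
  fixes F :: "(complex \<times> real) set"
  assumes "finite F" "\<forall>x\<in>F. snd x > 0"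
  shows "\<exists>G. finite G \<and> (\<forall>x\<in>G. snd x > 0) \<and> (\<Sum>x\<in>G. snd x) \<le> (\<Sum>x\<in>F. snd x) \<and>
    (\<forall>x\<in>F. \<exists>y\<in>G. cdisc x \<subseteq> cdisc y) \<and>
    (\<forall>x\<in>G. \<forall>y\<in>G. x \<noteq> y \<longrightarrow> cdisc x \<inter> cdisc y = {})"
  using assms
proof (induction "card F" arbitrary: F rule: less_induct)
  case less
  show ?case
  proof (cases "\<forall>x\<in>F. \<forall>y\<in>F. x \<noteq> y \<longrightarrow> cdisc x \<inter> cdisc y = {}")
    case True
    then show ?thesis using less.prems by (intro exI[of _ F]) blast
  next
    case False
    then obtain x y where xy: "x \<in> F" "y \<in> F" "x \<noteq> y" "cdisc x \<inter> cdisc y \<noteq> {}"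
      by blast
    then obtain c where c: "cdisc x \<subseteq> cball c (snd x + snd y)" "cdisc y \<subseteq> cball c (snd x + snd y)"
      using two_discs_in_disc[of "snd x" "snd y" "fst x" "fst y"] less.prems by blast
    define z where "z = (c, snd x + snd y)"
    define F' where "F' = insert z (F - {x, y})"
    have fin: "finite F'" using less.prems by (simp add: F'_def)
    have pos: "\<forall>x\<in>F'. snd x > 0"
      using less.prems xy by (auto simp: F'_def z_def add_pos_pos)
    have "card F' \<le> Suc (card (F - {x, y}))"
      unfolding F'_def using less.prems by (intro card_insert_le_m1) (auto simp: card_insert_if)
    also have "card (F - {x, y}) = card F - 2"
      using xy less.prems by (subst card_Diff_subset) auto
    also have "Suc (card F - 2) < card F"
    proof -
      have "card {x, y} \<le> card F" using xy less.prems by (intro card_mono) auto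
      then show ?thesis using xy by auto
    qed
    finally have "card F' < card F" .
    then obtain G where G: "finite G" "\<forall>x\<in>G. snd x > 0" "(\<Sum>x\<in>G. snd x) \<le> (\<Sum>x\<in>F'. snd x)"
      "\<forall>x\<in>F'. \<exists>y\<in>G. cdisc x \<subseteq> cdisc y" "\<forall>x\<in>G. \<forall>y\<in>G. x \<noteq> y \<longrightarrow> cdisc x \<inter> cdisc y = {}"
      using less.hyps[OF _ fin pos] by blast
    \<comment> \<open>Only an inequality, since \<open>z\<close> may already be among the remaining
      discs.\<close>
    have "(\<Sum>x\<in>F'. snd x) \<le> snd z + (\<Sum>x\<in>F - {x, y}. snd x)"
      unfolding F'_def using less.prems pos by (auto simp: sum.insert_if F'_def intro: less_imp_le)
    also have "\<dots> = (\<Sum>x\<in>F. snd x)"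
    proof -
      have "(\<Sum>x\<in>F. snd x) = (\<Sum>x\<in>F - {x, y}. snd x) + (\<Sum>x\<in>{x, y}. snd x)"
        using xy less.prems by (intro sum.subset_diff) auto
      then show ?thesis using xy by (simp add: z_def)
    qed
    finally have "(\<Sum>x\<in>G. snd x) \<le> (\<Sum>x\<in>F. snd x)" using G by linarith
    moreover have "\<exists>y\<in>G. cdisc u \<subseteq> cdisc y" if "u \<in> F" for u
    proof (cases "u = x \<or> u = y")
      case True
      then have "cdisc u \<subseteq> cdisc z" using c by (auto simp: z_def)
      moreover obtain v where "v \<in> G" "cdisc z \<subseteq> cdisc v" using G(4) by (auto simp: F'_def)
      ultimately show ?thesis by blast
    next
      case False
      then show ?thesis using G(4) that by (auto simp: F'_def)
    qed
    ultimately show ?thesis using G by blast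
  qed
qed

definition swiss :: "complex \<Rightarrow> real \<Rightarrow> (complex \<times> real) set \<Rightarrow> complex set" where
  "swiss a b H = cball a b - (\<Union>x\<in>H. odisc x)"

lemma compact_swiss: "compact (swiss a b H)"
  unfolding swiss_def by (intro compact_diff) auto

text \<open>The radii whose circle meets a given closed disc lie in an interval twice as long as its
  radius, so the forbidden intervals together are too short to cover
  \<open>c < r < d\<close>.\<close>

lemma circle_avoiding_discs:
  fixes G :: "(complex \<times> real) set"
  assumes "finite G" "\<forall>x\<in>G. snd x > 0" "2 * (\<Sum>x\<in>G. snd x) < d - c" "c < d"
  shows "\<exists>r. c < r \<and> r < d \<and> (\<forall>x\<in>G. snd x < \<bar>dist a (fst x) - r\<bar>)"
proof (rule ccontr)
  assume neg: "\<not> ?thesis"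
  let ?I = "\<lambda>x. {dist a (fst x) - snd x .. dist a (fst x) + snd x}"
  have sub: "{c<..<d} \<subseteq> (\<Union>x\<in>G. ?I x)"
  proof
    fix r assume "r \<in> {c<..<d}"
    then obtain x where "x \<in> G" "\<bar>dist a (fst x) - r\<bar> \<le> snd x" using neg by force
    then show "r \<in> (\<Union>x\<in>G. ?I x)" by (auto intro!: bexI[of _ x])
  qed
  have "measure lborel {c<..<d} \<le> measure lborel (\<Union>x\<in>G. ?I x)"
    using assms
    by (intro measure_mono_fmeasurable[OF sub] fmeasurable.finite_UN fmeasurableI) (auto simp: emeasure_lborel_Icc_eq)
  also have "\<dots> \<le> (\<Sum>x\<in>G. measure lborel (?I x))"
    using assms by (intro measure_UNION_le) auto
  also have "\<dots> = (\<Sum>x\<in>G. 2 * snd x)"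
    using assms by (intro sum.cong) (auto dest: less_imp_le)
  finally show False using assms by (simp add: sum_distrib_left)
qed

lemma contour_integral_circlepath_residues:
  assumes "finite pts" "f holomorphic_on - pts" "r > 0" "sphere a r \<inter> pts = {}"
  shows "contour_integral (circlepath a r) f = 2 * pi * \<i> * (\<Sum>p\<in>pts \<inter> ball a r. residue f p)"
proof -
  have "contour_integral (circlepath a r) f =
      2 * pi * \<i> * (\<Sum>p\<in>pts. winding_number (circlepath a r) p * residue f p)"
    using assms by (intro Residue_theorem[of UNIV]) (auto simp: Compl_eq_Diff_UNIV)
  also have "(\<Sum>p\<in>pts. winding_number (circlepath a r) p * residue f p) =
      (\<Sum>p\<in>pts \<inter> ball a r. residue f p)"
  proof (rule sum.mono_neutral_cong_right)
    show "\<forall>p\<in>pts - pts \<inter> ball a r. winding_number (circlepath a r) p * residue f p = 0"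
    proof
      fix p assume p: "p \<in> pts - pts \<inter> ball a r"
      then have "p \<notin> cball a r" using assms(4) by auto
      then have "winding_number (circlepath a r) p = 0"
        using assms(3) by (intro winding_number_zero_outside[of _ "cball a r"]) auto
      then show "winding_number (circlepath a r) p * residue f p = 0" by simp
    qed
  qed (use assms in \<open>auto simp: winding_number_circlepath dist_norm norm_minus_commute\<close>)
  finally show ?thesis .
qed

text \<open>On the circle, \<open>cnj (w - a)\<close> equals \<open>r^2 / (w - a)\<close>.\<close>

lemma contour_integral_circlepath_cnj:
  assumes "r > 0"
  shows "((\<lambda>w. cnj (w - a)) has_contour_integral (2 * pi * \<i> * r^2)) (circlepath a r)"
proof -
  have "((\<lambda>w. 1 / (w - a)) has_contour_integral (2 * pi * \<i>)) (circlepath a r)"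
    using Cauchy_integral_circlepath_simple[of "\<lambda>_. 1" a r a] assms by simp
  then have "((\<lambda>w. of_real (r^2) * (1 / (w - a))) has_contour_integral (of_real (r^2) * (2 * pi * \<i>))) (circlepath a r)"
    by (rule has_contour_integral_lmul)
  then have "((\<lambda>w. cnj (w - a)) has_contour_integral (of_real (r^2) * (2 * pi * \<i>))) (circlepath a r)"
  proof (rule has_contour_integral_eq)
    fix x assume "x \<in> path_image (circlepath a r)"
    then have x: "cmod (x - a) = r" using assms by (auto simp: dist_norm norm_minus_commute)
    have "(x - a) * cnj (x - a) = of_real (r^2)"
      using x by (metis complex_norm_square)
    moreover have "x - a \<noteq> 0" using x assms by auto
    ultimately show "of_real (r^2) * (1 / (x - a)) = cnj (x - a)"
      by (metis divide_inverse mult.commute mult_1 nonzero_mult_div_cancel_left)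
  qed
  then show ?thesis by (simp add: mult_ac)
qed

text \<open>A function closer than \<open>b / 8\<close> to \<open>cnj (w - a)\<close> on the cheese
  would have small integrals around the deleted discs, whose total circumference is small. By
  residues these integrals add up to the one over a large circle around \<open>a\<close>, which has
  to be near \<open>2 * pi * \<i> * r^2\<close>.\<close>

lemma swiss_cnj_not_approx:
  assumes b: "b > 0" and H: "\<forall>x\<in>H. snd x > 0"
    and small: "\<And>F. finite F \<Longrightarrow> F \<subseteq> H \<Longrightarrow> (\<Sum>x\<in>F. snd x) \<le> b / 16"
    and f: "hol_off (swiss a b H) f"
  shows "\<exists>w\<in>swiss a b H. cmod (f w - cnj (w - a)) \<ge> b / 8"
proof (rule ccontr)
  assume "\<not> ?thesis"
  then have close: "cmod (f w - cnj (w - a)) < b / 8" if "w \<in> swiss a b H" for w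
    using that by force
  obtain pts where pts: "finite pts" "pts \<inter> swiss a b H = {}" "f holomorphic_on - pts"
    using f by (auto simp: hol_off_def)
  have opts: "open (- pts)" using pts(1) by (intro open_Compl finite_imp_closed)
  have cf: "continuous_on (- pts) f" using pts(3) by (rule holomorphic_on_imp_continuous_on)
  \<comment> \<open>The estimate holds on an open neighbourhood of the cheese, so by compactness
    finitely many holes cover the rest of the closed disc, even if \<open>H\<close> is
    infinite.\<close>
  define V where "V = {w \<in> - pts. cmod (f w - cnj (w - a)) < b / 8}"
  have openV: "open V"
  proof -
    have "open (- pts \<inter> (\<lambda>w. cmod (f w - cnj (w - a))) -` {..<b/8})"
      by (intro continuous_open_preimage[OF _ opts] continuous_intros cf)
    moreover have "V = - pts \<inter> (\<lambda>w. cmod (f w - cnj (w - a))) -` {..<b/8}" by (auto simp: V_def)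
    ultimately show ?thesis by simp
  qed
  have QV: "swiss a b H \<subseteq> V" using close pts(2) by (auto simp: V_def)
  have c1: "compact (cball a b - V)" using openV by (intro compact_diff) auto
  have c2: "cball a b - V \<subseteq> (\<Union>x\<in>H. odisc x)"
    using QV by (auto simp: swiss_def)
  obtain F where F: "F \<subseteq> H" "finite F" "cball a b - V \<subseteq> (\<Union>x\<in>F. odisc x)"
    by (rule compactE_image[OF c1 _ c2]) auto
  obtain G where G: "finite G" "\<forall>x\<in>G. snd x > 0" "(\<Sum>x\<in>G. snd x) \<le> (\<Sum>x\<in>F. snd x)"
      "\<forall>x\<in>F. \<exists>y\<in>G. cdisc x \<subseteq> cdisc y" "\<forall>x\<in>G. \<forall>y\<in>G. x \<noteq> y \<longrightarrow> cdisc x \<inter> cdisc y = {}"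
    using disjoint_disc_cover[of F] F H by blast
  have sumG: "(\<Sum>x\<in>G. snd x) \<le> b / 16" using G(3) small[OF F(2,1)] by linarith
  obtain r where r: "b / 2 < r" "r < b" "\<forall>x\<in>G. snd x < \<bar>dist a (fst x) - r\<bar>"
    using circle_avoiding_discs[of G b "b/2" a] G sumG b by force
  have r0: "r > 0" using r b by linarith
  have cover: "\<exists>y\<in>G. w \<in> odisc y" if w: "w \<in> cball a b - V" for w
  proof -
    obtain x where x: "x \<in> F" "w \<in> odisc x" using F w by blast
    then obtain y where y: "y \<in> G" "cdisc x \<subseteq> cdisc y" using G by blast
    have "odisc x \<subseteq> interior (cdisc y)"
      using y(2) ball_subset_cball by (intro interior_maximal) (blast, simp)
    then have "w \<in> odisc y" using x by (auto simp: interior_cball)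
    then show ?thesis using y by blast
  qed
  have sphereV: "sphere a r \<subseteq> V"
  proof
    fix w assume w: "w \<in> sphere a r"
    show "w \<in> V"
    proof (rule ccontr)
      assume "w \<notin> V"
      then obtain y where y: "y \<in> G" "w \<in> odisc y" using cover[of w] w r by auto
      have "\<bar>dist a (fst y) - dist a w\<bar> \<le> dist (fst y) w"
        using dist_triangle[of a w "fst y"] dist_triangle2[of a "fst y" w]
        by (auto simp: dist_commute)
      then show False using y w r(3) by force
    qed
  qed
  \<comment> \<open>No disc of \<open>G\<close> meets the circle of radius \<open>r\<close>, so each
    lies wholly inside or wholly outside it; \<open>G'\<close> collects the inner ones.\<close>
  define G' where "G' = {x \<in> G. dist a (fst x) < r}"
  have finG': "finite G'" using G by (simp add: G'_def)
  have inside: "cdisc x \<subseteq> ball a r" if "x \<in> G'" for x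
  proof -
    have "dist a (fst x) + snd x < r" using r(3) that by (force simp: G'_def)
    then show ?thesis by (subst cball_subset_ball_iff) (auto simp: dist_commute)
  qed
  have outside: "cdisc x \<inter> ball a r = {}" if "x \<in> G - G'" for x
  proof -
    have "dist a (fst x) - snd x > r" using r(3) that by (force simp: G'_def)
    moreover have "dist a (fst x) \<le> dist a w + snd x" if "w \<in> cdisc x" for w
      using that dist_triangle2[of a "fst x" w] by (auto)
    ultimately show ?thesis by force
  qed
  have sphereV': "sphere (fst x) (snd x) \<subseteq> V" if x: "x \<in> G'" for x
  proof
    fix w assume w: "w \<in> sphere (fst x) (snd x)"
    show "w \<in> V"
    proof (rule ccontr)
      assume "w \<notin> V"
      moreover have "w \<in> cdisc x" using w by simp
      then have "w \<in> ball a r" using inside[OF x] by blast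
      ultimately obtain y where y: "y \<in> G" "w \<in> odisc y" using cover[of w] r by auto
      have "x \<noteq> y" using w y by auto
      moreover have "w \<in> cdisc x \<inter> cdisc y" using w y by simp
      ultimately show False using G(5) x y unfolding G'_def by blast
    qed
  qed
  have bound: "cmod (f w) \<le> 9 * b / 8" if "w \<in> V" "w \<in> cball a b" for w
  proof -
    have "cmod (f w) \<le> cmod (f w - cnj (w - a)) + cmod (cnj (w - a))"
      using norm_triangle_sub[of "f w" "cnj (w - a)"] by simp
    moreover have "cmod (cnj (w - a)) \<le> b"
      using that(2) by (metis complex_mod_cnj dist_norm dist_commute mem_cball)
    ultimately show ?thesis using that(1) by (simp add: V_def)
  qed
  have VP: "V \<inter> pts = {}" by (auto simp: V_def)
  have fint: "(f has_contour_integral contour_integral (circlepath c s) f) (circlepath c s)"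
    if "sphere c s \<subseteq> V" "s > 0" for c s
    using that VP pts(3)
    by (intro has_contour_integral_integral contour_integrable_continuous_circlepath
         continuous_on_subset[OF cf]) auto
  \<comment> \<open>\<open>V\<close> contains no singularity, and whatever lies inside the circle
    but off \<open>V\<close> is covered by the discs of \<open>G'\<close>.\<close>
  have split: "pts \<inter> ball a r = (\<Union>x\<in>G'. pts \<inter> odisc x)"
  proof
    show "(\<Union>x\<in>G'. pts \<inter> odisc x) \<subseteq> pts \<inter> ball a r"
      using inside ball_subset_cball by fastforce
    show "pts \<inter> ball a r \<subseteq> (\<Union>x\<in>G'. pts \<inter> odisc x)"
    proof
      fix p assume p: "p \<in> pts \<inter> ball a r"
      then have "p \<in> cball a b - V" using VP r by auto
      then obtain y where y: "y \<in> G" "p \<in> odisc y" using cover by blast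
      then have "p \<in> cdisc y \<inter> ball a r" using p by simp
      then have "y \<in> G'" using outside[of y] y by blast
      then show "p \<in> (\<Union>x\<in>G'. pts \<inter> odisc x)" using y p by auto
    qed
  qed
  have "contour_integral (circlepath a r) f = 2 * pi * \<i> * (\<Sum>p\<in>pts \<inter> ball a r. residue f p)"
    using sphereV VP pts r0 by (intro contour_integral_circlepath_residues) auto
  also have "(\<Sum>p\<in>pts \<inter> ball a r. residue f p) = (\<Sum>x\<in>G'. \<Sum>p\<in>pts \<inter> odisc x. residue f p)"
    unfolding split
  proof (rule sum.UNION_disjoint[OF finG'])
    show "\<forall>i\<in>G'. finite (pts \<inter> odisc i)" using pts by auto
    show "\<forall>i\<in>G'. \<forall>j\<in>G'. i \<noteq> j \<longrightarrow> pts \<inter> odisc i \<inter> (pts \<inter> odisc j) = {}"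
    proof (intro ballI impI)
      fix i j assume "i \<in> G'" "j \<in> G'" "i \<noteq> j"
      then have "cdisc i \<inter> cdisc j = {}" using G(5) by (simp add: G'_def)
      then show "pts \<inter> odisc i \<inter> (pts \<inter> odisc j) = {}" using ball_subset_cball by blast
    qed
  qed
  also have "2 * pi * \<i> * \<dots> = (\<Sum>x\<in>G'. 2 * pi * \<i> * (\<Sum>p\<in>pts \<inter> odisc x. residue f p))"
    by (rule sum_distrib_left)
  also have "\<dots> = (\<Sum>x\<in>G'. contour_integral (circlepath (fst x) (snd x)) f)"
  proof (rule sum.cong[OF refl])
    fix x assume x: "x \<in> G'"
    show "2 * pi * \<i> * (\<Sum>p\<in>pts \<inter> odisc x. residue f p) = contour_integral (circlepath (fst x) (snd x)) f"
      using sphereV'[OF x] VP pts x G(2) G'_def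
      by (intro contour_integral_circlepath_residues[symmetric]) auto
  qed
  finally have eq: "contour_integral (circlepath a r) f =
     (\<Sum>x\<in>G'. contour_integral (circlepath (fst x) (snd x)) f)" .
  have "cmod (contour_integral (circlepath a r) f) \<le> (\<Sum>x\<in>G'. (9 * b / 8) * (2 * pi * snd x))"
    unfolding eq
  proof (rule sum_norm_le)
    fix x assume x: "x \<in> G'"
    have s: "snd x > 0" using x G by (auto simp: G'_def)
    show "cmod (contour_integral (circlepath (fst x) (snd x)) f) \<le> (9 * b / 8) * (2 * pi * snd x)"
    proof (rule has_contour_integral_bound_circlepath[OF fint[OF sphereV'[OF x] s]])
      fix w assume "cmod (w - fst x) = snd x"
      then have w: "w \<in> sphere (fst x) (snd x)" by (simp add: dist_norm norm_minus_commute)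
      then have "w \<in> cdisc x" by simp
      then have "w \<in> ball a r" using inside[OF x] by blast
      then have "w \<in> cball a b" using r by simp
      then show "cmod (f w) \<le> 9 * b / 8" using bound sphereV'[OF x] w by blast
    qed (use b s in auto)
  qed
  also have "\<dots> = (9 * b / 8) * (2 * pi) * (\<Sum>x\<in>G'. snd x)"
    by (simp add: sum_distrib_left sum_distrib_right mult_ac)
  also have "(\<Sum>x\<in>G'. snd x) \<le> (\<Sum>x\<in>G. snd x)"
    using G by (intro sum_mono2) (auto simp: G'_def less_imp_le)
  also have "\<dots> \<le> b / 16" by (rule sumG)
  finally have upper: "cmod (contour_integral (circlepath a r) f) \<le> (9 * b / 8) * (2 * pi) * (b / 16)"
    using b by (simp add: mult_left_mono)
  have diff: "((\<lambda>w. f w - cnj (w - a)) has_contour_integral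
      (contour_integral (circlepath a r) f - 2 * pi * \<i> * r^2)) (circlepath a r)"
    using has_contour_integral_diff[OF fint[OF sphereV r0] contour_integral_circlepath_cnj[OF r0]] by simp
  have "cmod (contour_integral (circlepath a r) f - 2 * pi * \<i> * r^2) \<le> (b / 8) * (2 * pi * r)"
  proof (rule has_contour_integral_bound_circlepath[OF diff])
    fix w assume "cmod (w - a) = r"
    then have "w \<in> V" using sphereV by (auto simp: dist_norm norm_minus_commute)
    then show "cmod (f w - cnj (w - a)) \<le> b / 8" by (simp add: V_def)
  qed (use b r0 in auto)
  moreover have "cmod (2 * pi * \<i> * r^2) = 2 * pi * r^2"
    by (simp add: norm_mult norm_power)
  moreover have "cmod (2 * pi * \<i> * r^2) \<le> cmod (contour_integral (circlepath a r) f) +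
       cmod (contour_integral (circlepath a r) f - 2 * pi * \<i> * r^2)"
    by (metis norm_minus_commute norm_triangle_sub)
  ultimately have "2 * pi * r^2 \<le> (9 * b / 8) * (2 * pi) * (b / 16) + (b / 8) * (2 * pi * r)"
    using upper by linarith
  also have "\<dots> = 2 * pi * (9 * b^2 / 128 + b * r / 8)" by (simp add: algebra_simps power2_eq_square)
  \<comment> \<open>Since \<open>r > b / 2\<close>, the left side exceeds \<open>b * r / 2\<close>,
    and the surplus \<open>3 * b * r / 8\<close> is already more than
    \<open>9 * b^2 / 128\<close>.\<close>
  finally have "r^2 \<le> 9 * b^2 / 128 + b * r / 8" by simp
  moreover have "r * r > (b / 2) * r" using r r0 by (intro mult_strict_right_mono) auto
  moreover have "b * r \<ge> b * (b / 2)" using r b by (intro mult_left_mono) auto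
  moreover have "b * b > 0" using b by simp
  ultimately show False by (simp add: power2_eq_square)
qed

section \<open>A Swiss cheese with only trivial Jensen measures\<close>

text \<open>The \<open>N\<close>-th root \<open>u\<close> of \<open>z ^ N\<close> obtained from the
  logarithm differs from 1 by less than \<open>e / N\<close>, and \<open>z / u\<close> is an
  \<open>N\<close>-th root of unity.\<close>

lemma near_root_of_unity:
  fixes z :: complex
  assumes e: "0 < e" "e \<le> 1" and N: "N > 0" and z: "cmod (z ^ N - 1) < e / 4"
  shows "\<exists>j<N. cmod (z - cis (2 * pi * real j / real N)) < e / real N"
proof -
  define w where "w = Ln (z ^ N)"
  have "cmod w \<le> 2 * cmod (z ^ N - 1)"
    using norm_Ln_le[of "z ^ N - 1"] z e by (simp add: w_def)
  then have w: "cmod w < e / 2" using z by linarith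
  have "z ^ N \<noteq> 0"
  proof
    assume "z ^ N = 0"
    then show False using z e N by (auto simp: zero_power)
  qed
  define u where "u = exp (w / of_nat N)"
  have uN: "u ^ N = z ^ N"
    using N \<open>z ^ N \<noteq> 0\<close> by (simp add: u_def w_def flip: exp_of_nat_mult)
  have u0: "u \<noteq> 0" by (simp add: u_def)
  have "(z / u) ^ N = 1"
    using uN \<open>z ^ N \<noteq> 0\<close> by (simp add: power_divide)
  then have "z / u \<in> (\<lambda>k. cis (2 * pi * real k / real N)) ` {..<N}"
    using Complex.bij_betw_roots_unity[OF N] by (simp add: bij_betw_def)
  then obtain j where j: "j < N" "z / u = cis (2 * pi * real j / real N)" by auto
  have "z - cis (2 * pi * real j / real N) = cis (2 * pi * real j / real N) * (u - 1)"
    using j(2) u0 by (simp add: field_simps)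
  then have "cmod (z - cis (2 * pi * real j / real N)) = cmod (u - 1)"
    by (simp add: norm_mult)
  also have "\<dots> \<le> 3 / 2 * cmod (w / of_nat N)"
  proof -
    have "cmod (w / of_nat N) \<le> cmod w / 1"
      unfolding norm_divide using N by (intro divide_left_mono) auto
    then show ?thesis unfolding u_def using w e by (intro norm_exp_bounds) simp
  qed
  also have "\<dots> = (3 / 2 * cmod w) / real N" by (simp add: norm_divide)
  also have "\<dots> < e / real N" using w e N by (intro divide_strict_right_mono) auto
  finally show ?thesis using j(1) by blast
qed

text \<open>All pairs of a dense centre and a radius \<open>1 / (1 + n)\<close> are listed, each
  infinitely often, because the decoding of \<open>i\<close> drops its second component. So small
  discs near \<open>s\<close> recur with arbitrarily large index, as the Jensen argument
  requires.\<close>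

lemma recurrent_dense_discs:
  "\<exists>d :: nat \<Rightarrow> complex \<times> real. (\<forall>i. 0 < snd (d i) \<and> snd (d i) \<le> 1) \<and>
     (\<forall>s e m. e > 0 \<longrightarrow> (\<exists>i\<ge>m. dist s (fst (d i)) < snd (d i) / 2 \<and> 3 * snd (d i) < e))"
proof -
  obtain D :: "complex set" where D': "countable D \<and> (\<forall>X. open X \<longrightarrow> X \<noteq> {} \<longrightarrow> (\<exists>d\<in>D. d \<in> X))"
    using countable_dense_exists by (rule exE)
  have D: "countable D" "\<And>X. open X \<Longrightarrow> X \<noteq> {} \<Longrightarrow> \<exists>d\<in>D. d \<in> X" using D' by auto
  have Dne: "D \<noteq> {}" using D(2)[of UNIV] by auto
  define q where "q = from_nat_into D"
  define d where "d i = (q (fst (prod_decode (fst (prod_decode i)))),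
     1 / (1 + real (snd (prod_decode (fst (prod_decode i))))))" for i
  have "\<exists>i\<ge>m. dist s (fst (d i)) < snd (d i) / 2 \<and> 3 * snd (d i) < e" if "e > 0" for s e m
  proof -
    obtain n where n: "3 / e < real n" using reals_Archimedean2 by blast
    have n0: "1 + real n > 0" by simp
    have "3 < e * (1 + real n)" using n that by (simp add: field_simps)
    then have small: "3 * (1 / (1 + real n)) < e" using n0 by (simp add: divide_simps mult.commute)
    obtain a where a: "a \<in> D" "a \<in> ball s (1 / (1 + real n) / 2)"
      using D(2)[of "ball s (1 / (1 + real n) / 2)"] n0 by auto
    obtain k where k: "a = q k" using a(1) D(1) from_nat_into_surj unfolding q_def by metis
    show ?thesis
      using a(2) small k
      by (intro exI[of _ "prod_encode (prod_encode (k, n), m)"])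
         (simp add: d_def le_prod_encode_2)
  qed
  moreover have "0 < snd (d i) \<and> snd (d i) \<le> 1" for i by (simp add: d_def)
  ultimately show ?thesis by blast
qed

text \<open>If \<open>m\<close> is a Jensen measure at \<open>s\<close>, such an \<open>f\<close>
  gives \<open>0 = ln |f s| \<le> \<integral> ln |f| dm \<le> k * \<integral> ln l dm\<close>. So
  every continuous real function that is positive at \<open>s\<close> has a nonnegative integral,
  which forces \<open>m\<close> to be the point mass.\<close>

definition jensen_trivial :: "complex set \<Rightarrow> bool" where
  "jensen_trivial K \<longleftrightarrow> (\<forall>s\<in>K. \<forall>l :: complex \<Rightarrow> real.
     continuous_on K l \<and> (\<forall>w\<in>K. 0 < l w) \<and> 1 < l s \<longrightarrow>
     (\<exists>k f. hol_off K f \<and> f s = 1 \<and> (\<forall>w\<in>K. cmod (f w) < l w ^ k)))"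

text \<open>Empty interior leaves room for later cheeses in any open set. The last conjunct is the
  failure of uniform density, with one \<open>g\<close> and one distance \<open>e\<close> for all
  \<open>f\<close>.\<close>

definition cheese :: "complex set \<Rightarrow> bool" where
  "cheese K \<longleftrightarrow> compact K \<and> interior K = {} \<and> jensen_trivial K \<and>
     (\<exists>g e. continuous_on UNIV g \<and> e > 0 \<and>
        (\<forall>f. hol_off K f \<longrightarrow> (\<exists>w\<in>K. e \<le> cmod (f w - g w))))"

text \<open>Serves the points that lie in no cheese.\<close>

lemma jensen_trivial_singleton: "jensen_trivial {s}"
  unfolding jensen_trivial_def
  by (auto intro!: exI[of _ 1] exI[of _ "\<lambda>_. 1"] hol_off_const)

section \<open>Construction of the holes\<close>

locale hole_system =
  fixes d :: "nat \<Rightarrow> complex \<times> real" and c :: real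
  assumes d_pos: "0 < snd (d i)" and d_le: "snd (d i) \<le> 1"
    and recurrent: "e > 0 \<Longrightarrow> \<exists>i\<ge>m. dist s (fst (d i)) < snd (d i) / 2 \<and> 3 * snd (d i) < e"
    and c: "0 < c" "c \<le> 1"
begin

text \<open>Cubic growth makes \<open>2 ^ N i\<close> outweigh every \<open>C ^ (i ^ 2)\<close>. The
  successor absorbs the 1 that is lost in \<open>v_large\<close> and keeps \<open>N i\<close>
  positive.\<close>

definition N :: "nat \<Rightarrow> nat" where "N i = Suc (i ^ 3)"

lemma N_pos: "N i > 0" by (simp add: N_def)

text \<open>The centres are the zeros of \<open>1 - v i\<close>, equally spaced on the boundary
  circle of \<open>d i\<close>; the radii of block \<open>i\<close> add up to
  \<open>c * snd (d i) / 2 ^ i\<close>.\<close>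

definition hole :: "nat \<Rightarrow> nat \<Rightarrow> complex \<times> real" where
  "hole i j = (fst (d i) + of_real (snd (d i)) * cis (2 * pi * real j / real (N i)),
     c * snd (d i) / (2 ^ i * real (N i)))"

definition H :: "(complex \<times> real) set" where
  "H = (\<lambda>(i, j). hole i j) ` (SIGMA i:UNIV. {..<N i})"

lemma hole_pos: "snd (hole i j) > 0"
  using d_pos[of i] c N_pos[of i] by (simp add: hole_def)

lemma H_pos: "\<forall>x\<in>H. snd x > 0"
  by (auto simp: H_def hole_pos simp del: split_paired_All)

text \<open>Block \<open>i\<close> contributes at most \<open>c / 2 ^ i\<close>. Different indices
  might give the same hole, which only lowers the sum.\<close>

lemma sum_H:
  assumes "finite F" "F \<subseteq> H"
  shows "(\<Sum>x\<in>F. snd x) \<le> 2 * c"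
proof -
  obtain I where I: "I \<subseteq> (SIGMA i:UNIV. {..<N i})" "finite I" "F = (\<lambda>(i, j). hole i j) ` I"
    using finite_subset_image[OF assms(1)] assms(2) unfolding H_def by metis
  obtain n where n: "fst ` I \<subseteq> {..<n}"
    using I(2) finite_nat_iff_bounded by (metis finite_imageI)
  have "(\<Sum>x\<in>F. snd x) \<le> (\<Sum>(i, j)\<in>I. snd (hole i j))"
    unfolding I(3) using sum_image_le[OF I(2), of snd "\<lambda>(i, j). hole i j"] hole_pos
    by (auto simp: o_def case_prod_unfold less_imp_le)
  also have "\<dots> \<le> (\<Sum>(i, j)\<in>(SIGMA i:{..<n}. {..<N i}). snd (hole i j))"
    using I n by (intro sum_mono2) (auto simp: less_imp_le[OF hole_pos])
  also have "\<dots> = (\<Sum>i<n. \<Sum>j<N i. snd (hole i j))"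
    by (rule sum.Sigma[symmetric]) auto
  also have "\<dots> \<le> (\<Sum>i<n. c * (1 / 2) ^ i)"
  proof (rule sum_mono)
    fix i
    have "(\<Sum>j<N i. snd (hole i j)) = snd (d i) * (c * (1 / 2) ^ i)"
      using N_pos[of i] by (simp add: hole_def power_one_over field_simps)
    also have "\<dots> \<le> 1 * (c * (1 / 2) ^ i)" using c d_le[of i] by (intro mult_right_mono) auto
    finally show "(\<Sum>j<N i. snd (hole i j)) \<le> c * (1 / 2) ^ i" by simp
  qed
  also have "\<dots> = c * (2 * (1 - (1 / 2) ^ n))"
    by (simp add: sum_distrib_left[symmetric] sum_gp_strict)
  also have "\<dots> \<le> c * 2" using c by (intro mult_left_mono) auto
  finally show ?thesis by simp
qed

text \<open>Every ball contains the centre of some hole.\<close>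

lemma swiss_interior: "interior (swiss a b H) = {}"
proof (rule ccontr)
  assume "interior (swiss a b H) \<noteq> {}"
  then obtain s e where e: "e > 0" "ball s e \<subseteq> swiss a b H"
    by (meson all_not_in_conv mem_interior)
  obtain i where i: "dist s (fst (d i)) < snd (d i) / 2" "3 * snd (d i) < e"
    using recurrent[OF e(1)] by blast
  let ?p = "fst (hole i 0)"
  have "dist (fst (d i)) ?p = snd (d i)"
    using d_pos[of i] by (simp add: hole_def dist_norm)
  then have "dist s ?p < e"
    using i dist_triangle[of s ?p "fst (d i)"] d_pos[of i] by linarith
  then have "?p \<in> swiss a b H" using e by auto
  moreover have "hole i 0 \<in> H" using N_pos[of i] by (auto simp: H_def)
  ultimately show False using hole_pos[of i 0] by (auto simp: swiss_def)
qed

definition v :: "nat \<Rightarrow> complex \<Rightarrow> complex" where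
  "v i w = ((w - fst (d i)) / of_real (snd (d i))) ^ N i"

text \<open>Where \<open>v i\<close> is too close to 1, the normalised point is close to an
  \<open>N i\<close>-th root of unity, that is, \<open>w\<close> lies in a hole of block
  \<open>i\<close>.\<close>

lemma v_lower:
  assumes "w \<notin> (\<Union>x\<in>H. odisc x)"
  shows "cmod (1 - v i w) \<ge> c / (4 * 2 ^ i)"
proof (rule ccontr)
  let ?z = "(w - fst (d i)) / of_real (snd (d i))"
  assume "\<not> ?thesis"
  then have "cmod (?z ^ N i - 1) < (c / 2 ^ i) / 4"
    by (simp add: v_def norm_minus_commute field_simps)
  moreover have "c / 2 ^ i \<le> 1"
    using c by (simp add: divide_le_eq_1) (meson one_le_numeral one_le_power order_trans)
  ultimately obtain j where j: "j < N i"
      "cmod (?z - cis (2 * pi * real j / real (N i))) < (c / 2 ^ i) / real (N i)"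
    using near_root_of_unity[of "c / 2 ^ i" "N i" ?z] c N_pos by auto
  have "w - fst (hole i j) = of_real (snd (d i)) * (?z - cis (2 * pi * real j / real (N i)))"
    using d_pos[of i] by (simp add: hole_def field_simps)
  then have "dist (fst (hole i j)) w = snd (d i) * cmod (?z - cis (2 * pi * real j / real (N i)))"
    using d_pos[of i] by (simp add: dist_norm norm_minus_commute norm_mult)
  also have "\<dots> < snd (d i) * ((c / 2 ^ i) / real (N i))"
    using j(2) d_pos[of i] by (rule mult_strict_left_mono)
  also have "\<dots> = snd (hole i j)" by (simp add: hole_def)
  finally have "w \<in> odisc (hole i j)" by simp
  moreover have "hole i j \<in> H" using j(1) by (auto simp: H_def)
  ultimately show False using assms by blast
qed

lemma v_small:
  assumes "dist w (fst (d i)) < snd (d i) / 2"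
  shows "cmod (v i w) \<le> 1 / 2"
proof -
  have "cmod ((w - fst (d i)) / of_real (snd (d i))) \<le> 1 / 2"
    using assms d_pos[of i] by (simp add: norm_divide dist_norm field_simps)
  then have "cmod (v i w) \<le> (1 / 2) ^ N i"
    unfolding v_def norm_power by (intro power_mono) auto
  also have "\<dots> \<le> 1 / 2" by (simp add: N_def power_le_one)
  finally show ?thesis .
qed

lemma v_large:
  assumes "dist w (fst (d i)) \<ge> 2 * snd (d i)"
  shows "cmod (1 - v i w) \<ge> 2 ^ (i ^ 3)"
proof -
  have "cmod ((w - fst (d i)) / of_real (snd (d i))) \<ge> 2"
    using assms d_pos[of i] by (simp add: norm_divide dist_norm field_simps)
  then have "cmod (v i w) \<ge> 2 ^ N i"
    unfolding v_def norm_power by (intro power_mono) auto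
  moreover have "cmod (v i w) \<le> cmod (1 - v i w) + 1"
    using norm_triangle_ineq4[of 1 "1 - v i w"] by simp
  moreover have "(2::real) ^ N i = 2 * 2 ^ (i ^ 3)" by (simp add: N_def)
  moreover have "(1::real) \<le> 2 ^ (i ^ 3)" by simp
  ultimately show ?thesis by linarith
qed

text \<open>
  The function is \<open>1 / (1 - v i w)\<close>, normalised at \<open>s\<close>, for a disc of the system close to \<open>s\<close>. Removing
  the \<open>i\<close>-th block of holes around its poles bounds it by a constant times \<open>2 ^ i\<close>, and off twice the disc
  it is at most \<open>2 / 2 ^ (i ^ 3)\<close>. With \<open>k = i ^ 2\<close> the first bound has \<open>k\<close>-th root tending to 1 and the
  second one has \<open>k\<close>-th root tending to 0.
\<close>

lemma swiss_jensen_trivial: "jensen_trivial (swiss a b H)"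
  unfolding jensen_trivial_def
proof (intro ballI allI impI, elim conjE)
  fix s and l :: "complex \<Rightarrow> real"
  let ?Q = "swiss a b H"
  assume s: "s \<in> ?Q" and l: "continuous_on ?Q l" "\<forall>w\<in>?Q. 0 < l w" "1 < l s"
  define mu where "mu = (1 + l s) / 2"
  have mu: "1 < mu" "mu < l s" using l(3) by (auto simp: mu_def)
  obtain e where e: "e > 0" "\<And>w. w \<in> ?Q \<Longrightarrow> dist w s < e \<Longrightarrow> dist (l w) (l s) < l s - mu"
    using l(1) s mu unfolding continuous_on_iff by (metis diff_gt_0_iff_gt)
  have near: "mu < l w" if "w \<in> ?Q" "dist w s < e" for w
    using e(2)[OF that] by (auto simp: dist_real_def)
  obtain x where x: "x \<in> ?Q" "\<forall>w\<in>?Q. l x \<le> l w"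
    using continuous_attains_inf[OF compact_swiss _ l(1)] s by blast
  define nu where "nu = l x"
  have nu: "0 < nu" "\<And>w. w \<in> ?Q \<Longrightarrow> nu \<le> l w" using x l by (auto simp: nu_def)
  \<comment> \<open>Thresholds for the index \<open>i\<close>: \<open>m1\<close> gives
    \<open>4 ^ i \<le> mu ^ (i ^ 2)\<close> near \<open>s\<close>, \<open>m2\<close> absorbs the
    constant \<open>6 / c\<close> into \<open>2 ^ i\<close>, and \<open>m3\<close> gives
    \<open>4 / 2 ^ i \<le> nu\<close> away from \<open>s\<close>.\<close>
  obtain m1 where m1: "4 < mu ^ m1" using real_arch_pow[OF mu(1)] by blast
  obtain m2 where m2: "8 / c < 2 ^ m2" using real_arch_pow[of 2] by force
  obtain m3 where m3: "4 / nu < 2 ^ m3" using real_arch_pow[of 2] by force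
  obtain i where i: "i \<ge> max 1 (max m1 (max m2 m3))" "dist s (fst (d i)) < snd (d i) / 2" "3 * snd (d i) < e"
    using recurrent[OF e(1)] by blast
  have i1: "4 < mu ^ i" using m1 i(1) mu(1)
    by (meson less_le_trans max.bounded_iff power_increasing less_imp_le)
  have i2: "8 / c < 2 ^ i" using m2 i(1)
    by (meson less_le_trans max.bounded_iff power_increasing one_le_numeral)
  have i3: "4 / nu < 2 ^ i" using m3 i(1)
    by (meson less_le_trans max.bounded_iff power_increasing one_le_numeral)
  have vs: "cmod (1 - v i s) \<le> 3 / 2" "1 - v i s \<noteq> 0"
  proof -
    have "cmod (v i s) \<le> 1 / 2" using v_small i(2) .
    then show "cmod (1 - v i s) \<le> 3 / 2" "1 - v i s \<noteq> 0"
      using norm_triangle_ineq4[of 1 "v i s"] by auto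
  qed
  define f where "f w = (1 - v i s) / (1 - v i w)" for w
  have nz: "1 - v i w \<noteq> 0" if "w \<in> ?Q" for w
  proof
    assume "1 - v i w = 0"
    moreover have "c / (4 * 2 ^ i) > 0" using c by simp
    ultimately show False using v_lower[of w i] that by (simp add: swiss_def)
  qed
  have "hol_off ?Q f"
  proof (rule hol_offI)
    let ?P = "{w. 1 - v i w = 0}"
    show "?P \<inter> ?Q = {}" using nz by auto
    have "?P \<subseteq> (\<lambda>z. fst (d i) + of_real (snd (d i)) * z) ` {z. z ^ N i = 1}"
    proof
      fix w assume "w \<in> ?P"
      then have "((w - fst (d i)) / of_real (snd (d i))) ^ N i = 1" by (simp add: v_def)
      moreover have "w = fst (d i) + of_real (snd (d i)) * ((w - fst (d i)) / of_real (snd (d i)))"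
        using d_pos[of i] by simp
      ultimately show "w \<in> (\<lambda>z. fst (d i) + of_real (snd (d i)) * z) ` {z. z ^ N i = 1}" by blast
    qed
    moreover have "finite {z :: complex. z ^ N i = 1}"
      using finite_roots_unity[of "N i"] N_pos[of i] by simp
    ultimately show "finite ?P" by (meson finite_imageI finite_subset)
    show "f holomorphic_on - ?P"
      unfolding f_def v_def using d_pos[of i] by (intro holomorphic_intros) (auto simp: v_def)
  qed
  moreover have "f s = 1" using vs by (simp add: f_def)
  moreover have "cmod (f w) < l w ^ (i ^ 2)" if w: "w \<in> ?Q" for w
  proof (cases "dist w s < e")
    case True
    have "cmod (f w) \<le> (3 / 2) / (c / (4 * 2 ^ i))"
      unfolding f_def norm_divide using vs v_lower[of w i] w c by (intro frac_le) (auto simp: swiss_def)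
    also have "\<dots> = (6 / c) * 2 ^ i" using c by (simp add: field_simps)
    also have "\<dots> < 2 ^ i * 2 ^ i"
    proof -
      have "6 / c \<le> 8 / c" using c by (intro divide_right_mono) auto
      then show ?thesis using i2 by (intro mult_strict_right_mono) auto
    qed
    also have "\<dots> = 4 ^ i" by (simp flip: power_mult_distrib)
    also have "\<dots> \<le> (mu ^ i) ^ i" using i1 by (intro power_mono) auto
    also have "\<dots> = mu ^ (i ^ 2)" by (simp add: power2_eq_square flip: power_mult)
    also have "\<dots> \<le> l w ^ (i ^ 2)" using near[OF w True] mu by (intro power_mono) auto
    finally show ?thesis .
  next
    case False
    \<comment> \<open>As \<open>e\<close> exceeds three radii and \<open>s\<close> is within half a
      radius of the centre, \<open>w\<close> is outside the doubled disc.\<close>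
    have "dist w (fst (d i)) \<ge> 2 * snd (d i)"
      using False i dist_triangle[of w s "fst (d i)"] d_pos[of i] by (simp add: dist_commute)
    then have "cmod (1 - v i w) \<ge> 2 ^ (i ^ 3)" by (rule v_large)
    then have "cmod (f w) \<le> (3 / 2) / 2 ^ (i ^ 3)"
      unfolding f_def norm_divide using vs by (intro frac_le) auto
    also have "\<dots> < 4 / 2 ^ (i ^ 3)" by (rule divide_strict_right_mono) auto
    also have "\<dots> \<le> 4 ^ (i ^ 2) / 2 ^ (i ^ 3)"
    proof -
      have "(4::real) ^ 1 \<le> 4 ^ (i ^ 2)" using i(1) by (intro power_increasing) auto
      then show ?thesis by (intro divide_right_mono) auto
    qed
    also have "\<dots> = (4 / 2 ^ i) ^ (i ^ 2)"
      by (simp add: power_divide power2_eq_square power3_eq_cube mult.assoc flip: power_mult)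
    also have "\<dots> \<le> nu ^ (i ^ 2)"
      using i3 nu(1) by (intro power_mono) (auto simp: field_simps)
    also have "\<dots> \<le> l w ^ (i ^ 2)" using nu w by (intro power_mono) auto
    finally show ?thesis .
  qed
  ultimately show "\<exists>k f. hol_off ?Q f \<and> f s = 1 \<and> (\<forall>w\<in>?Q. cmod (f w) < l w ^ k)" by blast
qed

end

lemma cheese_exists:
  assumes "b > 0"
  shows "\<exists>K. cheese K \<and> K \<subseteq> cball a b"
proof -
  obtain d :: "nat \<Rightarrow> complex \<times> real" where d: "\<And>i. 0 < snd (d i) \<and> snd (d i) \<le> 1"
     "\<And>s e m. e > 0 \<Longrightarrow> \<exists>i\<ge>m. dist s (fst (d i)) < snd (d i) / 2 \<and> 3 * snd (d i) < e"
    using recurrent_dense_discs by metis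
  \<comment> \<open>Makes the bound \<open>2 * c\<close> on the total radius of the holes at most
    \<open>b / 16\<close>.\<close>
  define c where "c = min 1 (b / 32)"
  interpret hole_system d c
    using d assms by unfold_locales (auto simp: c_def)
  have "2 * c \<le> b / 16" by (simp add: c_def)
  then have small: "(\<Sum>x\<in>F. snd x) \<le> b / 16" if "finite F" "F \<subseteq> H" for F
    using sum_H[OF that] by linarith
  have "cheese (swiss a b H)"
    unfolding cheese_def
  proof (intro conjI exI[of _ "\<lambda>w. cnj (w - a)"] exI[of _ "b / 8"] allI impI)
    show "continuous_on UNIV (\<lambda>w. cnj (w - a))" by (intro continuous_intros)
    show "\<exists>w\<in>swiss a b H. b / 8 \<le> cmod (f w - cnj (w - a))" if "hol_off (swiss a b H) f" for f
      using swiss_cnj_not_approx[OF assms H_pos small that] .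
  qed (use assms in \<open>auto simp: compact_swiss swiss_interior swiss_jensen_trivial\<close>)
  then show ?thesis by (auto simp: swiss_def intro!: exI[of _ "swiss a b H"])
qed

section \<open>A dense null family of cheeses in the triangle\<close>

text \<open>Barycentric coordinates in the triangle with vertices 1, \<open>\<i>\<close> and 0. For
  \<open>z\<close> on the sphere, those of \<open>wmap z\<close> are the squared moduli of the
  coordinates of \<open>z\<close>.\<close>

definition bary :: "3 \<Rightarrow> complex \<Rightarrow> real" where
  "bary j w = (if j = 1 then Re w else if j = 2 then Im w else 1 - Re w - Im w)"

definition open_triangle :: "complex set" where
  "open_triangle = {w. \<forall>j. 0 < bary j w}"

definition closed_triangle :: "complex set" where
  "closed_triangle = {w. \<forall>j. 0 \<le> bary j w}"

lemma continuous_on_bary [continuous_intros]: "continuous_on S (bary j)"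
  unfolding bary_def by (cases "j = 1"; cases "j = 2") (auto intro!: continuous_intros)

lemma open_triangle_open: "open open_triangle"
proof -
  have eq: "open_triangle = (\<Inter>j\<in>UNIV. {w. 0 < bary j w})" by (auto simp: open_triangle_def)
  have "open {w. 0 < bary j w}" for j
    by (intro open_Collect_less continuous_intros)
  then show ?thesis unfolding eq by (intro open_INT) auto
qed

lemma open_triangle_nonempty: "open_triangle \<noteq> {}"
proof -
  have "Complex (1/4) (1/4) \<in> open_triangle" by (auto simp: open_triangle_def bary_def)
  then show ?thesis by blast
qed

text \<open>The cheeses are placed one after the other inside the members of a countable base, each
  off the union of the earlier ones; that union is closed with empty interior, so it never fills an
  open set.\<close>

lemma cheese_sequence:
  "\<exists>Q :: nat \<Rightarrow> complex set.
     (\<forall>n. cheese (Q n) \<and> Q n \<subseteq> open_triangle \<and> (\<exists>p. Q n \<subseteq> cball p (inverse (real (Suc n))))) \<and>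
     (\<forall>m n. m \<noteq> n \<longrightarrow> Q m \<inter> Q n = {}) \<and>
     (\<forall>U. open U \<and> U \<inter> open_triangle \<noteq> {} \<longrightarrow> (\<exists>n. Q n \<subseteq> U))"
proof -
  obtain B :: "complex set set" where B: "countable B" "topological_basis B"
    using ex_countable_basis by blast
  have Bne: "B \<noteq> {}" using B(2) unfolding topological_basis_def by (metis Sup_empty UNIV_not_empty open_UNIV subset_empty)
  \<comment> \<open>A base member that misses the triangle is replaced by the whole triangle, so
    that every step has room.\<close>
  define W where "W n = (let U = from_nat_into B n \<inter> open_triangle in if U = {} then open_triangle else U)" for n
  have W: "open (W n)" "W n \<noteq> {}" "W n \<subseteq> open_triangle" for n
    using topological_basis_open[OF B(2) from_nat_into[OF Bne, of n]]
    by (auto simp: W_def Let_def open_triangle_nonempty open_triangle_open)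
  have step: "\<exists>K. cheese K \<and> K \<subseteq> W n \<and> K \<inter> C = {} \<and> (\<exists>p. K \<subseteq> cball p (inverse (real (Suc n))))"
    if C: "closed C" "interior C = {}" for n C
  proof -
    have "W n - C \<noteq> {}"
      using C W by (metis Diff_eq_empty_iff interior_maximal subset_empty)
    then obtain p where p: "p \<in> W n - C" by blast
    have "open (W n - C)" using W C by (simp add: open_Diff)
    then obtain e where e: "e > 0" "cball p e \<subseteq> W n - C"
      using p open_contains_cball by blast
    obtain K where "cheese K" "K \<subseteq> cball p (min e (inverse (real (Suc n))))"
      using cheese_exists[of "min e (inverse (real (Suc n)))" p] e by auto
    moreover have "cball p (min e (inverse (real (Suc n)))) \<subseteq> cball p e"
      "cball p (min e (inverse (real (Suc n)))) \<subseteq> cball p (inverse (real (Suc n)))"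
      by auto
    ultimately show ?thesis using e by blast
  qed
  \<comment> \<open>The state is the current cheese together with a closed set of empty interior
    that holds all cheeses so far.\<close>
  let ?P = "\<lambda>n x. cheese (fst x) \<and> fst x \<subseteq> W n \<and> (\<exists>p. fst x \<subseteq> cball p (inverse (real (Suc n)))) \<and>
     closed (snd x) \<and> interior (snd x) = {} \<and> fst x \<subseteq> snd x"
  have "\<exists>X. \<forall>n. ?P n (X n) \<and> (fst (X (Suc n)) \<inter> snd (X n) = {} \<and> snd (X n) \<subseteq> snd (X (Suc n)))"
  proof (rule dependent_nat_choice)
    obtain K where "cheese K" "K \<subseteq> W 0" "\<exists>p. K \<subseteq> cball p (inverse (real (Suc 0)))"
      using step[of "{}" 0] by auto
    then show "\<exists>x. ?P 0 x"
      by (intro exI[of _ "(K, K)"]) (auto simp: cheese_def compact_imp_closed)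
  next
    fix x :: "complex set \<times> complex set" and n assume x: "?P n x"
    then obtain K where K: "cheese K" "K \<subseteq> W (Suc n)" "K \<inter> snd x = {}"
        "\<exists>p. K \<subseteq> cball p (inverse (real (Suc (Suc n))))"
      using step[of "snd x" "Suc n"] by auto
    have "closed (snd x \<union> K)" "interior (snd x \<union> K) = {}"
      using x K by (auto simp: cheese_def compact_imp_closed interior_closed_Un_empty_interior)
    then show "\<exists>y. ?P (Suc n) y \<and> fst y \<inter> snd x = {} \<and> snd x \<subseteq> snd y"
      using K by (intro exI[of _ "(K, snd x \<union> K)"]) auto
  qed
  then obtain X where X: "\<And>n. ?P n (X n)" "\<And>n. fst (X (Suc n)) \<inter> snd (X n) = {}"
    "\<And>n. snd (X n) \<subseteq> snd (X (Suc n))" by blast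
  have mono: "m \<le> n \<Longrightarrow> snd (X m) \<subseteq> snd (X n)" for m n
    using X(3) by (rule lift_Suc_mono_le)
  have lt: "fst (X m) \<inter> fst (X n) = {}" if mn: "m < n" for m n
  proof -
    obtain k where k: "n = Suc k" "m \<le> k" using mn by (cases n) auto
    have "fst (X m) \<subseteq> snd (X k)" using X(1)[of m] mono[OF k(2)] by blast
    then show ?thesis using X(2)[of k] k by blast
  qed
  have disj: "fst (X m) \<inter> fst (X n) = {}" if "m \<noteq> n" for m n
    using lt[of m n] lt[of n m] that by (cases m n rule: linorder_cases) auto
  have dense: "\<exists>n. fst (X n) \<subseteq> U" if U: "open U" "U \<inter> open_triangle \<noteq> {}" for U
  proof -
    obtain x where x: "x \<in> U" "x \<in> open_triangle" using U by blast
    obtain b where b: "b \<in> B" "x \<in> b" "b \<subseteq> U"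
      using topological_basisE[OF B(2) U(1) x(1)] by blast
    obtain n where n: "from_nat_into B n = b"
      using from_nat_into_surj[OF B(1) b(1)] by blast
    have "W n \<subseteq> b" using x b n by (auto simp: W_def Let_def)
    then show ?thesis using X(1)[of n] b(3) by blast
  qed
  show ?thesis
    using X(1) W(3) disj dense by (intro exI[of _ "\<lambda>n. fst (X n)"]) blast
qed

locale cheese_family =
  fixes Q :: "nat \<Rightarrow> complex set"
  assumes Q_cheese: "cheese (Q n)"
    and Q_tri: "Q n \<subseteq> open_triangle"
    and Q_null: "\<exists>p. Q n \<subseteq> cball p (inverse (real (Suc n)))"
    and Q_disj: "m \<noteq> n \<Longrightarrow> Q m \<inter> Q n = {}"
    and Q_dense: "\<lbrakk>open U; U \<inter> open_triangle \<noteq> {}\<rbrakk> \<Longrightarrow> \<exists>n. Q n \<subseteq> U"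
begin

lemma Q_closed: "closed (Q n)" and Q_compact: "compact (Q n)"
  using Q_cheese[of n] by (auto simp: cheese_def compact_imp_closed)

section \<open>The quotient of the plane that collapses each cheese to a point\<close>

definition sat :: "complex set \<Rightarrow> complex set" where
  "sat K = K \<union> \<Union>{Q n | n. Q n \<inter> K \<noteq> {}}"

definition saturated :: "complex set \<Rightarrow> bool" where
  "saturated U \<longleftrightarrow> (\<forall>n. Q n \<inter> U \<noteq> {} \<longrightarrow> Q n \<subseteq> U)"

lemma saturated_sat: "saturated (sat K)"
  unfolding saturated_def
proof (intro allI impI)
  fix n assume "Q n \<inter> sat K \<noteq> {}"
  then consider "Q n \<inter> K \<noteq> {}" | m where "Q m \<inter> K \<noteq> {}" "Q n \<inter> Q m \<noteq> {}"
    by (auto simp: sat_def)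
  then have "Q n \<inter> K \<noteq> {}"
  proof cases
    case (2 m)
    then have "n = m" using Q_disj by blast
    then show ?thesis using 2 by simp
  qed
  then show "Q n \<subseteq> sat K" by (auto simp: sat_def)
qed

lemma saturated_Compl: "saturated U \<longleftrightarrow> saturated (- U)"
  unfolding saturated_def by blast

text \<open>Only finitely many of the sets have a large diameter; this makes saturations closed.\<close>

lemma closed_sat:
  assumes "closed K"
  shows "closed (sat K)"
proof -
  have "\<exists>T. open T \<and> x \<in> T \<and> T \<subseteq> - sat K" if x: "x \<in> - sat K" for x
  proof -
    have "x \<in> - K" using x by (auto simp: sat_def)
    then obtain e where e: "e > 0" "ball x e \<subseteq> - K"
      using assms by (meson open_Compl open_contains_ball)
    \<comment> \<open>From index \<open>k\<close> on, the cheeses have diameter below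
      \<open>e / 2\<close>. One that meets \<open>K\<close> has a point at distance at least
      \<open>e\<close> from \<open>x\<close>, so it cannot reach
      \<open>ball x (e / 2)\<close>.\<close>
    obtain k where k: "inverse (real (Suc k)) < e / 4"
      using reals_Archimedean[of "e / 4"] e by auto
    define F where "F = \<Union>{Q n | n. n < k \<and> Q n \<inter> K \<noteq> {}}"
    have "{Q n | n. n < k \<and> Q n \<inter> K \<noteq> {}} \<subseteq> Q ` {..<k}" by auto
    then have "finite {Q n | n. n < k \<and> Q n \<inter> K \<noteq> {}}" by (rule finite_subset) auto
    then have "closed F" unfolding F_def using Q_closed by (intro closed_Union) auto
    moreover have "x \<notin> F" using x by (auto simp: F_def sat_def)
    moreover have "y \<notin> sat K" if y: "y \<in> ball x (e / 2)" "y \<notin> F" for y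
    proof
      assume "y \<in> sat K"
      moreover have "y \<in> ball x e" using y e(1) by simp
      then have "y \<notin> K" using e(2) by blast
      ultimately obtain n where n: "y \<in> Q n" "Q n \<inter> K \<noteq> {}" by (auto simp: sat_def)
      have "n \<ge> k"
      proof (rule ccontr)
        assume "\<not> n \<ge> k"
        then have "y \<in> F" using n unfolding F_def by (auto intro!: exI[of _ "Q n"])
        then show False using y(2) by blast
      qed
      then have nk: "inverse (real (Suc n)) \<le> inverse (real (Suc k))" by simp
      obtain z where z: "z \<in> Q n" "z \<in> K" using n by blast
      obtain p where p: "Q n \<subseteq> cball p (inverse (real (Suc n)))" using Q_null by blast
      have "dist p y \<le> inverse (real (Suc n))" "dist p z \<le> inverse (real (Suc n))"
        using p n(1) z(1) by auto
      then have "dist y z < e / 2"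
        using dist_triangle3[of y z p] nk k by linarith
      moreover have "dist x y < e / 2" using y by simp
      ultimately have "dist x z < e" using dist_triangle[of x z y] by linarith
      then show False using z e by auto
    qed
    ultimately show ?thesis using e
      by (intro exI[of _ "ball x (e / 2) - F"]) (auto simp: open_Diff)
  qed
  then show ?thesis by (metis closed_def open_subopen)
qed

text \<open>The quotient topology, kept on the plane itself through its saturated open sets. Points
  of one cheese are not separated; Urysohn's lemma asks only for normality.\<close>

definition satop :: "complex topology" where
  "satop = topology (\<lambda>U. open U \<and> saturated U)"

lemma openin_satop: "openin satop U \<longleftrightarrow> open U \<and> saturated U"
proof -
  have "istopology (\<lambda>U. open U \<and> saturated U)"
    unfolding istopology_def
  proof (intro conjI allI impI)
    fix S T assume "open S \<and> saturated S" "open T \<and> saturated T"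
    then show "open (S \<inter> T)" "saturated (S \<inter> T)" unfolding saturated_def by blast+
  next
    fix \<K> assume k: "\<forall>K\<in>\<K>. open K \<and> saturated K"
    then show "open (\<Union>\<K>)" by blast
    show "saturated (\<Union>\<K>)" using k unfolding saturated_def by blast
  qed
  then show ?thesis by (simp add: satop_def)
qed

lemma topspace_satop [simp]: "topspace satop = UNIV"
proof -
  have "openin satop UNIV" by (auto simp: openin_satop saturated_def)
  then show ?thesis using openin_subset by blast
qed

lemma closedin_satop: "closedin satop K \<longleftrightarrow> closed K \<and> saturated K"
  using saturated_Compl[of K] by (auto simp: closedin_def openin_satop closed_def Compl_eq_Diff_UNIV)

text \<open>Ordinary separating sets are shrunk to saturated ones: \<open>- sat (- U)\<close>
  consists of the classes contained in \<open>U\<close>, and it is open because saturations of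
  closed sets are closed.\<close>

lemma normal_satop: "normal_space satop"
  unfolding normal_space_def
proof (intro allI impI)
  fix S T assume "closedin satop S \<and> closedin satop T \<and> disjnt S T"
  then have S: "closed S" "saturated S" and T: "closed T" "saturated T" and d: "S \<inter> T = {}"
    by (auto simp: closedin_satop disjnt_def)
  obtain U V where U: "open U" "S \<subseteq> U" and V: "open V" "T \<subseteq> V" and UV: "U \<inter> V = {}"
    by (rule separation_normal[OF S(1) T(1) d]) (rule that)
  have *: "openin satop (- sat (- U)) \<and> S \<subseteq> - sat (- U) \<and> - sat (- U) \<subseteq> U"
    if "open U" "S \<subseteq> U" "saturated S" for U S
  proof -
    have "open (- sat (- U))" using closed_sat[OF closed_Compl[OF that(1)]] by (rule open_Compl)
    moreover have "S \<inter> sat (- U) = {}"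
      using that(2,3) unfolding sat_def saturated_def by blast
    moreover have "- sat (- U) \<subseteq> U" by (auto simp: sat_def)
    ultimately show ?thesis using saturated_sat saturated_Compl by (auto simp: openin_satop)
  qed
  show "\<exists>U V. openin satop U \<and> openin satop V \<and> S \<subseteq> U \<and> T \<subseteq> V \<and> disjnt U V"
    using *[OF U S(2)] *[OF V T(2)] UV
    by (intro exI[of _ "- sat (- U)"] exI[of _ "- sat (- V)"]) (auto simp: disjnt_def)
qed

definition Qconst :: "(complex \<Rightarrow> real) \<Rightarrow> bool" where
  "Qconst u \<longleftrightarrow> continuous_on UNIV u \<and> (\<forall>n. \<forall>x\<in>Q n. \<forall>y\<in>Q n. u x = u y)"

text \<open>Comes from a Urysohn function for \<open>satop\<close>: its preimages of open sets are
  open and saturated, which yields both continuity and constancy on each cheese.\<close>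

lemma cutoff:
  assumes K: "closed K" "saturated K" and V: "open V" "K \<subseteq> V"
  shows "\<exists>u. Qconst u \<and> (\<forall>x. 0 \<le> u x \<and> u x \<le> 1) \<and> (\<forall>x\<in>K. u x = 1) \<and> closure {x. u x \<noteq> 0} \<subseteq> V"
proof -
  have "closedin satop (sat (- V))"
    using closed_sat[OF closed_Compl[OF V(1)]] saturated_sat by (simp add: closedin_satop)
  moreover have "disjnt (sat (- V)) K"
    using K(2) V(2) unfolding disjnt_def sat_def saturated_def by blast
  ultimately obtain f :: "complex \<Rightarrow> real" where f: "continuous_map satop (top_of_set {0..1}) f"
      "f ` sat (- V) \<subseteq> {0}" "f ` K \<subseteq> {1}"
    using Urysohn_lemma[OF normal_satop, of "sat (- V)" K 0 1] K by (auto simp: closedin_satop)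
  have fm: "continuous_map satop euclideanreal f" using f(1) continuous_map_in_subtopology by blast
  have f01: "0 \<le> f x \<and> f x \<le> 1" for x
    using f(1) by (auto simp: continuous_map_in_subtopology image_subset_iff)
  have pre: "open (f -` S) \<and> saturated (f -` S)" if "open S" for S
    using fm that unfolding continuous_map_def by (auto simp: openin_satop vimage_def)
  have cont: "continuous_on UNIV f" using pre by (simp add: continuous_on_open_vimage)
  have const: "f x = f y" if "x \<in> Q n" "y \<in> Q n" for n x y
  proof (rule ccontr)
    assume "f x \<noteq> f y"
    moreover have "saturated (f -` (- {f y}))" using pre[of "- {f y}"] by (simp add: open_Compl)
    ultimately show False using that unfolding saturated_def by blast
  qed
  \<comment> \<open>Cutting off below the level 1/2 turns vanishing outside \<open>V\<close> into a
    support whose closure is inside \<open>V\<close>.\<close>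
  define u where "u x = max 0 (2 * f x - 1)" for x
  have "closure {x. u x \<noteq> 0} \<subseteq> {x. 1 / 2 \<le> f x}"
  proof (rule closure_minimal)
    show "{x. u x \<noteq> 0} \<subseteq> {x. 1 / 2 \<le> f x}" by (auto simp: u_def max_def split: if_splits)
    show "closed {x. 1 / 2 \<le> f x}" by (intro closed_Collect_le continuous_intros cont)
  qed
  moreover have "{x. 1 / 2 \<le> f x} \<subseteq> V" using f(2) by (force simp: sat_def)
  moreover have "Qconst u"
    unfolding Qconst_def
  proof (intro conjI allI ballI)
    show "continuous_on UNIV u" unfolding u_def by (intro continuous_intros cont)
    show "u x = u y" if "x \<in> Q n" "y \<in> Q n" for n x y
      using const[OF that] by (simp add: u_def)
  qed
  moreover have "\<forall>x\<in>K. u x = 1" using f(3) by (auto simp: u_def)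
  moreover have "\<forall>x. 0 \<le> u x \<and> u x \<le> 1" using f01 by (auto simp: u_def)
  ultimately show ?thesis by blast
qed

end

section \<open>Torus means of functions in the ball algebra\<close>

text \<open>Cauchy's formula for the Taylor coefficient of order \<open>n\<close>; the
  parametrisation turns \<open>du / (2 * pi * \<i> * u)\<close> into \<open>dt\<close>.\<close>

lemma circle_mean:
  assumes "r > 0" "continuous_on (cball 0 r) g" "g holomorphic_on ball 0 r"
  shows "((\<lambda>t. g (of_real r * cis (2 * pi * t)) / (of_real r * cis (2 * pi * t)) ^ n) has_integral
    (deriv ^^ n) g 0 / fact n) {0..1}"
proof -
  have "((\<lambda>u. g u / (u - 0) ^ Suc n) has_contour_integral ((2 * pi * \<i>) / fact n * (deriv ^^ n) g 0))
      (circlepath 0 r)"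
    using assms by (intro Cauchy_has_contour_integral_higher_derivative_circlepath) auto
  then have "((\<lambda>t. g (circlepath 0 r t) / (circlepath 0 r t) ^ Suc n *
      vector_derivative (circlepath 0 r) (at t within {0..1})) has_integral
      ((2 * pi * \<i>) / fact n * (deriv ^^ n) g 0)) {0..1}"
    by (simp add: has_contour_integral_def)
  then have "((\<lambda>t. (2 * pi * \<i>) * (g (of_real r * cis (2 * pi * t)) / (of_real r * cis (2 * pi * t)) ^ n)) has_integral
      ((2 * pi * \<i>) / fact n * (deriv ^^ n) g 0)) {0..1}"
  proof (rule has_integral_eq[rotated])
    fix t :: real assume t: "t \<in> {0..1}"
    have c: "circlepath 0 r t = of_real r * cis (2 * pi * t)"
      by (simp add: circlepath cis_conv_exp mult_ac)
    have "vector_derivative (circlepath 0 r) (at t within {0..1}) = 2 * pi * \<i> * (of_real r * cis (2 * pi * t))"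
      using t by (simp add: vector_derivative_circlepath01 cis_conv_exp mult_ac)
    then show "g (circlepath 0 r t) / (circlepath 0 r t) ^ Suc n *
      vector_derivative (circlepath 0 r) (at t within {0..1}) =
      (2 * pi * \<i>) * (g (of_real r * cis (2 * pi * t)) / (of_real r * cis (2 * pi * t)) ^ n)"
      using assms(1) by (simp add: c)
  qed
  then have "((\<lambda>t. inverse (2 * pi * \<i>) * ((2 * pi * \<i>) * (g (of_real r * cis (2 * pi * t)) / (of_real r * cis (2 * pi * t)) ^ n))) has_integral
      (inverse (2 * pi * \<i>) * ((2 * pi * \<i>) / fact n * (deriv ^^ n) g 0))) {0..1}"
    by (rule has_integral_mult_right)
  then show ?thesis by (simp add: field_simps)
qed

text \<open>What matters is that the right-hand side does not involve \<open>r\<close>.\<close>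

lemma circle_mean_radius:
  assumes "0 < r" "r \<le> R" "continuous_on (cball 0 R) g" "g holomorphic_on ball 0 R"
  shows "integral {0..1} (\<lambda>t. g (of_real r * cis (2 * pi * t)) / (of_real r * cis (2 * pi * t)) ^ n) =
    (deriv ^^ n) g 0 / fact n"
proof -
  have "continuous_on (cball 0 r) g" "g holomorphic_on ball 0 r"
    using assms by (auto intro: continuous_on_subset holomorphic_on_subset)
  then show ?thesis using circle_mean[of r g n] assms(1) integral_unique by blast
qed

abbreviation cube :: "(real \<times> real \<times> real) set" where
  "cube \<equiv> cbox (0, 0, 0) (1, 1, 1)"

text \<open>Three orders of integration, so that each angle in turn can be the innermost
  variable.\<close>

lemma integral_cube:
  fixes f :: "real \<Rightarrow> real \<Rightarrow> real \<Rightarrow> complex"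
  assumes "continuous_on UNIV (\<lambda>(x, y, z). f x y z)"
  shows "integral cube (\<lambda>(x, y, z). f x y z) =
           integral {0..1} (\<lambda>x. integral {0..1} (\<lambda>y. integral {0..1} (\<lambda>z. f x y z)))" (is ?A)
    and "integral cube (\<lambda>(x, y, z). f x y z) =
           integral {0..1} (\<lambda>x. integral {0..1} (\<lambda>z. integral {0..1} (\<lambda>y. f x y z)))" (is ?B)
    and "integral cube (\<lambda>(x, y, z). f x y z) =
           integral (cbox (0, 0) (1, 1)) (\<lambda>(y, z). integral {0..1} (\<lambda>x. f x y z))" (is ?C)
proof -
  have f: "continuous_on S (\<lambda>p. f (fst p) (fst (snd p)) (snd (snd p)))" for S
    using continuous_on_subset[OF assms] by (simp add: case_prod_unfold)
  have in2: "continuous_on S (\<lambda>(y, z). f x y z)" for S x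
  proof -
    have "continuous_on S (\<lambda>p. f (fst (x, p)) (fst (snd (x, p))) (snd (snd (x, p))))"
      by (rule continuous_on_compose2[OF f[of UNIV]]) (auto intro!: continuous_intros)
    then show ?thesis by (simp add: case_prod_unfold)
  qed
  have 1: "integral cube (\<lambda>(x, y, z). f x y z) =
      integral (cbox 0 1) (\<lambda>x. integral (cbox (0, 0) (1, 1)) (\<lambda>(y, z). f x y z))"
    using integral_prod_continuous[of 0 "(0, 0)" 1 "(1, 1)" "\<lambda>(x, y, z). f x y z"] f
    by (simp add: case_prod_unfold)
  have 2: "integral (cbox (0, 0) (1, 1)) (\<lambda>(y, z). f x y z) =
      integral {0..1} (\<lambda>y. integral {0..1} (\<lambda>z. f x y z))" for x
    using integral_prod_continuous[of 0 0 1 1 "\<lambda>(y, z). f x y z"] in2 by simp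
  have 3: "integral {0..1} (\<lambda>y. integral {0..1} (\<lambda>z. f x y z)) =
      integral {0..1} (\<lambda>z. integral {0..1} (\<lambda>y. f x y z))" for x
    using integral_swap_continuous[of 0 0 1 1 "\<lambda>y z. f x y z"] in2 by simp
  show ?A using 1 2 by simp
  then show ?B using 3 by simp
  show ?C
    using 1 integral_swap_continuous[of 0 "(0, 0)" 1 "(1, 1)" "\<lambda>x (y, z). f x y z"] f
    by (simp add: case_prod_unfold)
qed

section \<open>Coordinates on the sphere and slices of the ball\<close>

definition wmap :: "complex^3 \<Rightarrow> complex" where
  "wmap z = Complex ((cmod (z$1))\<^sup>2) ((cmod (z$2))\<^sup>2)"

text \<open>The section of \<open>wmap\<close> over the triangle with nonnegative real
  coordinates.\<close>

definition sec :: "complex \<Rightarrow> complex^3" where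
  "sec w = (\<chi> j. of_real (sqrt (bary j w)))"

definition upd :: "complex^3 \<Rightarrow> 3 \<Rightarrow> complex \<Rightarrow> complex^3" where
  "upd z j x = (\<chi> i. if i = j then x else z$i)"

lemma norm_sq_vec3: "(norm (z :: complex^3))\<^sup>2 = (cmod (z$1))\<^sup>2 + (cmod (z$2))\<^sup>2 + (cmod (z$3))\<^sup>2"
  by (simp add: norm_vec_def L2_set_def sum_3)

lemma norm_sq_upd: "(norm (upd z j x))\<^sup>2 = (norm z)\<^sup>2 - (cmod (z$j))\<^sup>2 + (cmod x)\<^sup>2"
  using exhaust_3[of j] by (auto simp: norm_sq_vec3 upd_def)

lemma norm_upd_le:
  assumes "cmod x \<le> r" "norm (upd z j (of_real r)) \<le> 1" shows "norm (upd z j x) \<le> 1"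
proof -
  have "(cmod x)\<^sup>2 \<le> r\<^sup>2" using assms(1) by (intro power_mono) auto
  then have "(norm (upd z j x))\<^sup>2 \<le> (norm (upd z j (of_real r)))\<^sup>2" by (simp add: norm_sq_upd)
  also have "\<dots> \<le> 1" using assms(2) by (simp add: power_le_one)
  finally show ?thesis by (simp add: power2_le_imp_le abs_square_le_1)
qed

lemma norm_upd_less:
  assumes "cmod x < r" "norm (upd z j (of_real r)) \<le> 1" shows "norm (upd z j x) < 1"
proof -
  have "(cmod x)\<^sup>2 < r\<^sup>2" using assms(1) by (intro power_strict_mono) auto
  then have "(norm (upd z j x))\<^sup>2 < (norm (upd z j (of_real r)))\<^sup>2" by (simp add: norm_sq_upd)
  also have "\<dots> \<le> 1" using assms(2) by (simp add: power_le_one)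
  finally show ?thesis by (simp add: abs_square_less_1)
qed

lemma slice_holomorphic:
  assumes F: "holomorphic_on3 F (ball 0 1)" and r: "norm (upd z j (of_real r)) \<le> 1"
  shows "(\<lambda>x. F (upd z j x)) holomorphic_on ball 0 r"
proof -
  have "(\<lambda>x. F (upd z j x)) field_differentiable at x" if x: "x \<in> ball 0 r" for x
  proof -
    have "upd z j x \<in> ball 0 1" using norm_upd_less[OF _ r, of x] x by simp
    then obtain D where D: "(F has_derivative D) (at (upd z j x))" "\<And>c v. D (c *s v) = c * D v"
      using F unfolding holomorphic_on3_def by blast
    have "upd z j = (\<lambda>x. upd z j 0 + x *s axis j 1)"
      by (auto simp: fun_eq_iff vec_eq_iff upd_def axis_def)
    moreover have "((\<lambda>x. upd z j 0 + x *s axis j 1) has_derivative (\<lambda>h. 0 + h *s axis j 1)) (at x)"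
    proof (intro derivative_intros)
      have "linear (\<lambda>h::complex. h *s (axis j 1 :: complex^3))"
        by (intro linearI) (auto simp: vec_eq_iff algebra_simps)
      then show "((\<lambda>x. x *s (axis j 1 :: complex^3)) has_derivative (\<lambda>h. h *s axis j 1)) (at x)"
        by (simp add: linear_conv_bounded_linear bounded_linear_imp_has_derivative)
    qed
    ultimately have "(upd z j has_derivative (\<lambda>h. h *s axis j 1)) (at x)" by simp
    then have "((\<lambda>x. F (upd z j x)) has_derivative (\<lambda>h. D (h *s axis j 1))) (at x)"
      using D(1) by (rule has_derivative_compose)
    then have "((\<lambda>x. F (upd z j x)) has_field_derivative D (axis j 1)) (at x)"
      by (simp add: has_field_derivative_def D(2) mult_commute_abs)
    then show ?thesis by (auto simp: field_differentiable_def)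
  qed
  then show ?thesis by (simp add: holomorphic_on_def field_differentiable_at_within)
qed

lemma slice_continuous:
  assumes F: "continuous_on (cball 0 1) F" and r: "norm (upd z j (of_real r)) \<le> 1"
  shows "continuous_on (cball 0 r) (\<lambda>x. F (upd z j x))"
proof (rule continuous_on_compose2[OF F])
  have "continuous_on (cball 0 r) (\<lambda>x. if i = j then x else z$i)" for i
    by (cases "i = j") auto
  then show "continuous_on (cball 0 r) (upd z j)"
    unfolding upd_def by (rule continuous_on_vec_lambda)
  show "upd z j ` cball 0 r \<subseteq> cball 0 1"
    using norm_upd_le[OF _ r] by auto
qed

text \<open>Both sides are the same Taylor coefficient of one slice, taken on the disc of the larger
  radius.\<close>

lemma slice_mean_radius:
  assumes F: "continuous_on (cball 0 1) F" "holomorphic_on3 F (ball 0 1)"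
    and r: "0 < r" "0 < s" "norm (upd z j (of_real r)) \<le> 1" "norm (upd z j (of_real s)) \<le> 1"
  shows "integral {0..1} (\<lambda>t. F (upd z j (of_real r * cis (2 * pi * t))) / (of_real r * cis (2 * pi * t)) ^ n) =
         integral {0..1} (\<lambda>t. F (upd z j (of_real s * cis (2 * pi * t))) / (of_real s * cis (2 * pi * t)) ^ n)"
proof -
  have R: "norm (upd z j (of_real (max r s))) \<le> 1" using r by (simp add: max_def)
  note * = circle_mean_radius[OF _ _ slice_continuous[OF F(1) R] slice_holomorphic[OF F(2) R]]
  show ?thesis using *[of r] *[of s] r by simp
qed


definition tri :: "complex \<Rightarrow> complex \<Rightarrow> complex \<Rightarrow> complex^3" where
  "tri x y z = vector [x, y, z]"

lemma tri_nth [simp]: "tri x y z $ 1 = x" "tri x y z $ 2 = y" "tri x y z $ 3 = z"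
  by (simp_all add: tri_def)

lemma tri_upd:
  "tri x y z = upd (tri x y 0) 3 z" "tri x y z = upd (tri x 0 z) 2 y" "tri x y z = upd (tri 0 y z) 1 x"
  by (simp_all add: vec_eq_iff upd_def forall_3)

lemma norm_sq_tri: "(norm (tri x y z))\<^sup>2 = (cmod x)\<^sup>2 + (cmod y)\<^sup>2 + (cmod z)\<^sup>2"
  by (simp add: norm_sq_vec3)

lemma continuous_on_tri [continuous_intros]:
  assumes "continuous_on S f" "continuous_on S g" "continuous_on S h"
  shows "continuous_on S (\<lambda>t. tri (f t) (g t) (h t))"
proof -
  have "continuous_on S (\<lambda>t. (\<chi> i. if i = 1 then f t else if i = 2 then g t else h t) :: complex^3)"
  proof (rule continuous_on_vec_lambda)
    fix i :: 3
    show "continuous_on S (\<lambda>t. if i = 1 then f t else if i = 2 then g t else h t)"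
      using assms by (cases "i = 1"; cases "i = 2") auto
  qed
  moreover have "tri (f t) (g t) (h t) = (\<chi> i. if i = 1 then f t else if i = 2 then g t else h t)" for t
    by (simp add: vec_eq_iff forall_3)
  ultimately show ?thesis by simp
qed

definition ang :: "real \<Rightarrow> real \<Rightarrow> complex" where
  "ang r t = of_real r * cis (2 * pi * t)"

lemma cmod_ang [simp]: "cmod (ang r t) = \<bar>r\<bar>"
  by (simp add: ang_def norm_mult)

lemma continuous_on_ang [continuous_intros]:
  "continuous_on S f \<Longrightarrow> continuous_on S (\<lambda>t. ang r (f t))"
  unfolding ang_def by (intro continuous_intros)

lemma ang_nonzero: "r > 0 \<Longrightarrow> ang r t \<noteq> 0"
  by (metis cmod_ang norm_zero abs_of_pos less_irrefl)

definition torus_mean :: "(complex^3 \<Rightarrow> complex) \<Rightarrow> real \<Rightarrow> real \<Rightarrow> real \<Rightarrow> complex" where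
  "torus_mean G r s q = integral cube (\<lambda>(x, y, z). G (tri (ang r x) (ang s y) (ang q z)))"

text \<open>One radius is changed at a time, with its angle integrated innermost; the powers of the
  other two coordinates pass through that integral. Going downwards keeps the intermediate triples
  in the ball.\<close>

lemma torus_mean_radius:
  fixes F :: "complex^3 \<Rightarrow> complex" and a b c :: nat
  assumes F: "continuous_on (cball 0 1) F" "holomorphic_on3 F (ball 0 1)"
    and r: "0 < r" "0 < s" "0 < q" "r\<^sup>2 + s\<^sup>2 + q\<^sup>2 \<le> 1"
    and r': "0 < r'" "0 < s'" "0 < q'" "r' \<le> r" "s' \<le> s" "q' \<le> q"
  defines "G \<equiv> \<lambda>z. F z / (z$1 ^ a * z$2 ^ b * z$3 ^ c)"
  shows "torus_mean G r s q = torus_mean G r' s' q'"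
proof -
  have cont: "continuous_on UNIV (\<lambda>(x, y, z). G (tri (ang r x) (ang s y) (ang q z)))"
    if "0 < r" "0 < s" "0 < q" "r\<^sup>2 + s\<^sup>2 + q\<^sup>2 \<le> 1" for r s q
  proof -
    let ?T = "\<lambda>t :: real \<times> real \<times> real. tri (ang r (fst t)) (ang s (fst (snd t))) (ang q (snd (snd t)))"
    have T: "continuous_on UNIV ?T" by (intro continuous_intros)
    have "norm (?T t) \<le> 1" for t
      by (rule power2_le_imp_le[OF _ zero_le_one]) (use that in \<open>simp add: norm_sq_tri\<close>)
    then have FT: "continuous_on UNIV (\<lambda>t. F (?T t))"
      by (intro continuous_on_compose2[OF F(1) T]) (simp add: image_subset_iff)
    have "continuous_on UNIV (\<lambda>t. F (?T t) / (ang r (fst t) ^ a * ang s (fst (snd t)) ^ b * ang q (snd (snd t)) ^ c))"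
      using that by (intro continuous_on_divide FT continuous_on_mult continuous_on_power continuous_on_ang
          continuous_on_fst continuous_on_snd continuous_on_id) (simp add: ang_nonzero)
    then show ?thesis by (simp add: G_def case_prod_unfold)
  qed
  have nrm: "norm (tri (ang r x) (ang s y) (ang q z)) \<le> 1" if "r\<^sup>2 + s\<^sup>2 + q\<^sup>2 \<le> 1" for r s q x y z
    by (rule power2_le_imp_le[OF _ zero_le_one]) (use that in \<open>simp add: norm_sq_tri\<close>)
  have of_real_ang: "of_real r = ang r 0" for r by (simp add: ang_def)
  have sq: "r'\<^sup>2 \<le> r\<^sup>2" "s'\<^sup>2 \<le> s\<^sup>2" "q'\<^sup>2 \<le> q\<^sup>2" using r' by (auto intro!: power_mono)
  have adm: "r\<^sup>2 + s\<^sup>2 + q'\<^sup>2 \<le> 1" "r\<^sup>2 + s'\<^sup>2 + q'\<^sup>2 \<le> 1" "r'\<^sup>2 + s'\<^sup>2 + q'\<^sup>2 \<le> 1"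
    using r(4) sq by linarith+
  note cont' = cont[OF r] cont[OF r(1,2) r'(3) adm(1)] cont[OF r(1) r'(2,3) adm(2)] cont[OF r'(1-3) adm(3)]
  have "torus_mean G r s q = torus_mean G r s q'"
  proof -
    have "integral {0..1} (\<lambda>z. G (tri (ang r x) (ang s y) (ang q z))) =
          integral {0..1} (\<lambda>z. G (tri (ang r x) (ang s y) (ang q' z)))" for x y
    proof -
      let ?z = "tri (ang r x) (ang s y) 0"
      have "norm (upd ?z 3 (of_real q)) \<le> 1" "norm (upd ?z 3 (of_real q')) \<le> 1"
        using nrm[of r s q x y 0] nrm[of r s q' x y 0] r(4) adm by (simp_all add: of_real_ang flip: tri_upd)
      from slice_mean_radius[OF F r(3) r'(3) this, of c]
      have "integral {0..1} (\<lambda>t. F (upd ?z 3 (ang q t)) / ang q t ^ c) / (ang r x ^ a * ang s y ^ b) =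
         integral {0..1} (\<lambda>t. F (upd ?z 3 (ang q' t)) / ang q' t ^ c) / (ang r x ^ a * ang s y ^ b)"
        by (simp add: ang_def)
      then show ?thesis
        by (simp add: G_def mult_ac flip: tri_upd integral_divide)
    qed
    then show ?thesis
      unfolding torus_mean_def integral_cube(1)[OF cont'(1)] integral_cube(1)[OF cont'(2)] by simp
  qed
  also have "\<dots> = torus_mean G r s' q'"
  proof -
    have "integral {0..1} (\<lambda>y. G (tri (ang r x) (ang s y) (ang q' z))) =
          integral {0..1} (\<lambda>y. G (tri (ang r x) (ang s' y) (ang q' z)))" for x z
    proof -
      let ?z = "tri (ang r x) 0 (ang q' z)"
      have "norm (upd ?z 2 (of_real s)) \<le> 1" "norm (upd ?z 2 (of_real s')) \<le> 1"
        using nrm[of r s q' x 0 z] nrm[of r s' q' x 0 z] r(4) adm by (simp_all add: of_real_ang flip: tri_upd)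
      from slice_mean_radius[OF F r(2) r'(2) this, of b]
      have "integral {0..1} (\<lambda>t. F (upd ?z 2 (ang s t)) / ang s t ^ b) / (ang r x ^ a * ang q' z ^ c) =
         integral {0..1} (\<lambda>t. F (upd ?z 2 (ang s' t)) / ang s' t ^ b) / (ang r x ^ a * ang q' z ^ c)"
        by (simp add: ang_def)
      then show ?thesis
        by (simp add: G_def mult_ac flip: tri_upd integral_divide)
    qed
    then show ?thesis
      unfolding torus_mean_def integral_cube(2)[OF cont'(2)] integral_cube(2)[OF cont'(3)] by simp
  qed
  also have "\<dots> = torus_mean G r' s' q'"
  proof -
    have "integral {0..1} (\<lambda>x. G (tri (ang r x) (ang s' y) (ang q' z))) =
          integral {0..1} (\<lambda>x. G (tri (ang r' x) (ang s' y) (ang q' z)))" for y z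
    proof -
      let ?z = "tri 0 (ang s' y) (ang q' z)"
      have "norm (upd ?z 1 (of_real r)) \<le> 1" "norm (upd ?z 1 (of_real r')) \<le> 1"
        using nrm[of r s' q' 0 y z] nrm[of r' s' q' 0 y z] r(4) adm by (simp_all add: of_real_ang flip: tri_upd)
      from slice_mean_radius[OF F r(1) r'(1) this, of a]
      have "integral {0..1} (\<lambda>t. F (upd ?z 1 (ang r t)) / ang r t ^ a) / (ang s' y ^ b * ang q' z ^ c) =
         integral {0..1} (\<lambda>t. F (upd ?z 1 (ang r' t)) / ang r' t ^ a) / (ang s' y ^ b * ang q' z ^ c)"
        by (simp add: ang_def)
      then show ?thesis
        by (simp add: G_def mult_ac flip: tri_upd integral_divide)
    qed
    then show ?thesis
      unfolding torus_mean_def integral_cube(3)[OF cont'(3)] integral_cube(3)[OF cont'(4)] by simp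
  qed
  finally show ?thesis .
qed

text \<open>\<open>C\<close> is the Taylor coefficient of \<open>F\<close> at the origin with
  exponents \<open>a\<close>, \<open>b\<close>, \<open>c\<close>. Two triples of radii are compared
  through their coordinatewise minimum, the reference triple being
  \<open>1/2, 1/2, 1/2\<close>.\<close>

lemma torus_mean_const:
  fixes F :: "complex^3 \<Rightarrow> complex"
  assumes F: "continuous_on (cball 0 1) F" "holomorphic_on3 F (ball 0 1)"
  shows "\<exists>C. \<forall>r s q. 0 < r \<and> 0 < s \<and> 0 < q \<and> r\<^sup>2 + s\<^sup>2 + q\<^sup>2 \<le> 1 \<longrightarrow>
     torus_mean (\<lambda>z. F z / (z$1 ^ a * z$2 ^ b * z$3 ^ c)) r s q = C"
proof -
  let ?G = "\<lambda>z. F z / (z$1 ^ a * z$2 ^ b * z$3 ^ c)"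
  have "torus_mean ?G r s q = torus_mean ?G (1/2) (1/2) (1/2)"
    if r: "0 < r" "0 < s" "0 < q" "r\<^sup>2 + s\<^sup>2 + q\<^sup>2 \<le> 1" for r s q
  proof -
    have "torus_mean ?G r s q = torus_mean ?G (min r (1/2)) (min s (1/2)) (min q (1/2))"
      using r by (intro torus_mean_radius[OF F]) auto
    also have "\<dots> = torus_mean ?G (1/2) (1/2) (1/2)"
      using r by (intro torus_mean_radius[OF F, symmetric]) (auto simp: power2_eq_square)
    finally show ?thesis .
  qed
  then show ?thesis by blast
qed

section \<open>Functions over a single cheese\<close>

lemma holomorphic_on3_const: "holomorphic_on3 (\<lambda>z. c) U"
  unfolding holomorphic_on3_def by (auto intro!: exI[of _ "\<lambda>_. 0"])

lemma holomorphic_on3_mult: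
  assumes "holomorphic_on3 f U" "holomorphic_on3 g U"
  shows "holomorphic_on3 (\<lambda>z. f z * g z) U"
  unfolding holomorphic_on3_def
proof
  fix z assume z: "z \<in> U"
  obtain D where D: "(f has_derivative D) (at z)" "\<And>c v. D (c *s v) = c * D v"
    using assms(1) z unfolding holomorphic_on3_def by blast
  obtain E where E: "(g has_derivative E) (at z)" "\<And>c v. E (c *s v) = c * E v"
    using assms(2) z unfolding holomorphic_on3_def by blast
  have "((\<lambda>z. f z * g z) has_derivative (\<lambda>h. f z * E h + D h * g z)) (at z)"
    using D(1) E(1) by (rule has_derivative_mult)
  then show "\<exists>D. ((\<lambda>z. f z * g z) has_derivative D) (at z) \<and> (\<forall>c v. D (c *s v) = c * D v)"
    by (intro exI[of _ "\<lambda>h. f z * E h + D h * g z"]) (auto simp: D(2) E(2) algebra_simps)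
qed

lemma holomorphic_on3_linear:
  assumes "bounded_linear L" "\<And>c v. L (c *s v) = c * L v"
  shows "holomorphic_on3 L U"
  unfolding holomorphic_on3_def
  using assms bounded_linear_imp_has_derivative by blast

lemma bounded_linear_nth: "bounded_linear (\<lambda>z :: complex^3. z $ j)"
  by (rule bounded_linear_vec_nth)

lemma holomorphic_on3_nth: "holomorphic_on3 (\<lambda>z. z $ j) U"
  using bounded_linear_nth by (rule holomorphic_on3_linear) auto

lemma norm_torus_act [simp]: "norm (torus_act t z) = norm z"
  by (simp add: norm_vec_def torus_act_def norm_mult)

lemma bounded_linear_torus_act: "bounded_linear (torus_act t)"
proof (rule bounded_linear_intro[where K=1])
  show "norm (torus_act t x) \<le> norm x * 1" for x by simp
qed (simp_all add: vec_eq_iff torus_act_def algebra_simps)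

lemma continuous_on_torus_act: "continuous_on S (torus_act t)"
  using bounded_linear_torus_act by (simp add: linear_continuous_on)

lemma holomorphic_on3_torus_act:
  assumes "holomorphic_on3 F (ball 0 1)"
  shows "holomorphic_on3 (\<lambda>z. F (torus_act t z)) (ball 0 1)"
  unfolding holomorphic_on3_def
proof
  fix z :: "complex^3" assume "z \<in> ball 0 1"
  then have "torus_act t z \<in> ball 0 1" by simp
  then obtain D where D: "(F has_derivative D) (at (torus_act t z))" "\<And>c v. D (c *s v) = c * D v"
    using assms unfolding holomorphic_on3_def by blast
  have "(torus_act t has_derivative torus_act t) (at z)"
    using bounded_linear_torus_act by (rule bounded_linear_imp_has_derivative)
  then have "((\<lambda>z. F (torus_act t z)) has_derivative (\<lambda>h. D (torus_act t h))) (at z)"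
    using D(1) by (rule has_derivative_compose)
  moreover have "torus_act t (c *s v) = c *s torus_act t v" for c v
    by (simp add: torus_act_def vec_eq_iff)
  ultimately show "\<exists>D. ((\<lambda>z. F (torus_act t z)) has_derivative D) (at z) \<and> (\<forall>c v. D (c *s v) = c * D v)"
    by (intro exI[of _ "\<lambda>h. D (torus_act t h)"]) (auto simp: D(2))
qed

lemma torus_act_nth [simp]: "torus_act t z $ j = cis (t$j) * z$j"
  by (simp add: torus_act_def)

lemma wmap_torus_act [simp]: "wmap (torus_act t z) = wmap z"
  by (simp add: wmap_def torus_act_def norm_mult)

lemma continuous_on_wmap [continuous_intros]:
  "continuous_on S f \<Longrightarrow> continuous_on S (\<lambda>x. wmap (f x))"
  unfolding wmap_def Complex_eq by (intro continuous_intros)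

lemma bary_wmap: "z \<in> unit_sphere3 \<Longrightarrow> bary j (wmap z) = (cmod (z$j))\<^sup>2"
  using norm_sq_vec3[of z] exhaust_3[of j] by (auto simp: bary_def wmap_def)

lemma sum_bary: "bary 1 w + bary 2 w + bary 3 w = 1"
  by (simp add: bary_def)

text \<open>Over \<open>K \<subseteq> open_triangle\<close> no coordinate vanishes, so the
  denominators are harmless there. They are what later bounds the coordinates under a character from
  below.\<close>

inductive leaf_fun :: "complex set \<Rightarrow> (complex^3 \<Rightarrow> complex) \<Rightarrow> bool" for K where
  base: "\<lbrakk>continuous_on (cball 0 1) F; holomorphic_on3 F (ball 0 1); hol_off K f\<rbrakk> \<Longrightarrow>
    leaf_fun K (\<lambda>z. F z * f (wmap z) / (z$1 ^ a * z$2 ^ b * z$3 ^ c))"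
| add: "\<lbrakk>leaf_fun K G; leaf_fun K H\<rbrakk> \<Longrightarrow> leaf_fun K (\<lambda>z. G z + H z)"

lemma leaf_fun_ball:
  assumes "continuous_on (cball 0 1) F" "holomorphic_on3 F (ball 0 1)"
  shows "leaf_fun K F"
  using leaf_fun.base[OF assms hol_off_const[of K 1], of 0 0 0] by simp

lemma leaf_fun_const: "leaf_fun K (\<lambda>z. c)"
  by (rule leaf_fun_ball) (auto intro: holomorphic_on3_const)

lemma leaf_fun_mult:
  assumes "leaf_fun K G" "leaf_fun K H"
  shows "leaf_fun K (\<lambda>z. G z * H z)"
  using assms(1)
proof induction
  case (base F f a b c)
  show ?case
    using assms(2)
  proof induction
    case (base F' f' a' b' c')
    have "(\<lambda>z. F z * f (wmap z) / (z$1 ^ a * z$2 ^ b * z$3 ^ c) * (F' z * f' (wmap z) / (z$1 ^ a' * z$2 ^ b' * z$3 ^ c'))) =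
      (\<lambda>z. (F z * F' z) * (f (wmap z) * f' (wmap z)) / (z$1 ^ (a + a') * z$2 ^ (b + b') * z$3 ^ (c + c')))"
      by (simp add: fun_eq_iff power_add mult_ac)
    moreover have "leaf_fun K \<dots>"
      by (intro leaf_fun.base[where f="\<lambda>w. f w * f' w"] continuous_on_mult holomorphic_on3_mult
          hol_off_mult base \<open>continuous_on (cball 0 1) F\<close> \<open>holomorphic_on3 F (ball 0 1)\<close> \<open>hol_off K f\<close>)
    ultimately show ?case by simp
  next
    case (add G H)
    then show ?case using leaf_fun.add by (simp add: distrib_left)
  qed
next
  case (add G H')
  then show ?case using leaf_fun.add by (simp add: distrib_right)
qed

lemma leaf_fun_torus_act:
  assumes "leaf_fun K G"
  shows "leaf_fun K (\<lambda>z. G (torus_act t z))"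
  using assms
proof induction
  case (base F f a b c)
  \<comment> \<open>A rotation changes the denominator by a unimodular constant, which is moved into
    the holomorphic factor.\<close>
  define k where "k = inverse (cis (t$1) ^ a * cis (t$2) ^ b * cis (t$3) ^ c)"
  have "(\<lambda>z. F (torus_act t z) * f (wmap (torus_act t z)) /
      (torus_act t z $ 1 ^ a * torus_act t z $ 2 ^ b * torus_act t z $ 3 ^ c)) =
    (\<lambda>z. (k * F (torus_act t z)) * f (wmap z) / (z$1 ^ a * z$2 ^ b * z$3 ^ c))"
    by (simp add: fun_eq_iff k_def power_mult_distrib divide_inverse mult_ac)
  moreover have "leaf_fun K \<dots>"
  proof (intro leaf_fun.base holomorphic_on3_mult holomorphic_on3_const holomorphic_on3_torus_act base)
    have "continuous_on (cball 0 1) (\<lambda>z. F (torus_act t z))"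
      by (rule continuous_on_compose2[OF base(1) continuous_on_torus_act]) auto
    then show "continuous_on (cball 0 1) (\<lambda>z. k * F (torus_act t z))"
      by (intro continuous_intros)
  qed
  ultimately show ?case by simp
next
  case (add G H)
  then show ?case using leaf_fun.add by simp
qed

text \<open>On the torus over \<open>w\<close> the factor \<open>f (wmap z)\<close> is the constant
  \<open>f w\<close>, and the remaining mean is the same \<open>C\<close> for all \<open>w\<close>.
  The continuity clause is carried along so that the integral of a sum can be split.\<close>

lemma leaf_fun_mean:
  assumes "leaf_fun K G" and K: "K \<subseteq> open_triangle"
  shows "\<exists>h. hol_off K h \<and> (\<forall>w\<in>K.
    continuous_on cube (\<lambda>(x, y, z). G (tri (ang (sqrt (bary 1 w)) x) (ang (sqrt (bary 2 w)) y) (ang (sqrt (bary 3 w)) z))) \<and>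
    torus_mean G (sqrt (bary 1 w)) (sqrt (bary 2 w)) (sqrt (bary 3 w)) = h w)"
  using assms(1)
proof induction
  case (base F f a b c)
  let ?F = "\<lambda>z. F z / (z$1 ^ a * z$2 ^ b * z$3 ^ c)"
  obtain C where C: "\<And>r s q. 0 < r \<Longrightarrow> 0 < s \<Longrightarrow> 0 < q \<Longrightarrow> r\<^sup>2 + s\<^sup>2 + q\<^sup>2 \<le> 1 \<Longrightarrow> torus_mean ?F r s q = C"
    using torus_mean_const[OF base(1,2)] by meson
  have "continuous_on cube (\<lambda>(x, y, z). F (tri (ang r x) (ang s y) (ang q z)) * f (wmap (tri (ang r x) (ang s y) (ang q z))) /
         (tri (ang r x) (ang s y) (ang q z) $ 1 ^ a * tri (ang r x) (ang s y) (ang q z) $ 2 ^ b * tri (ang r x) (ang s y) (ang q z) $ 3 ^ c)) \<and>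
     torus_mean (\<lambda>z. F z * f (wmap z) / (z$1 ^ a * z$2 ^ b * z$3 ^ c)) r s q = f w * C"
    if w: "w \<in> K" and rsq: "r = sqrt (bary 1 w)" "s = sqrt (bary 2 w)" "q = sqrt (bary 3 w)" for w r s q
  proof -
    have pos: "0 < bary j w" for j using K w by (auto simp: open_triangle_def)
    have r: "0 < r" "0 < s" "0 < q" using pos rsq by auto
    have sq: "r\<^sup>2 = bary 1 w" "s\<^sup>2 = bary 2 w" "q\<^sup>2 = bary 3 w" using less_imp_le[OF pos] rsq by auto
    have sum: "r\<^sup>2 + s\<^sup>2 + q\<^sup>2 = 1" unfolding sq by (rule sum_bary)
    let ?T = "\<lambda>t :: real \<times> real \<times> real. tri (ang r (fst t)) (ang s (fst (snd t))) (ang q (snd (snd t)))"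
    have wT: "wmap (tri (ang r x) (ang s y) (ang q z)) = w" for x y z
      by (simp add: wmap_def sq) (simp add: bary_def)
    have T: "continuous_on cube ?T" by (intro continuous_intros)
    have "norm (?T t) \<le> 1" for t
      by (rule power2_le_imp_le[OF _ zero_le_one]) (simp add: norm_sq_tri sum)
    then have FT: "continuous_on cube (\<lambda>t. F (?T t))"
      by (intro continuous_on_compose2[OF base(1) T]) (simp add: image_subset_iff)
    have "continuous_on cube (\<lambda>t. F (?T t) * f w / (ang r (fst t) ^ a * ang s (fst (snd t)) ^ b * ang q (snd (snd t)) ^ c))"
      using r by (intro continuous_on_divide FT continuous_on_mult continuous_on_power continuous_on_ang
          continuous_on_fst continuous_on_snd continuous_on_id continuous_on_const) (simp add: ang_nonzero)
    moreover have "torus_mean (\<lambda>z. F z * f (wmap z) / (z$1 ^ a * z$2 ^ b * z$3 ^ c)) r s q = f w * torus_mean ?F r s q"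
      unfolding torus_mean_def by (simp add: wT case_prod_unfold mult_ac flip: integral_mult_right)
    ultimately show ?thesis using C[OF r] sum by (simp add: wT case_prod_unfold)
  qed
  moreover have "hol_off K (\<lambda>w. f w * C)" using base(3) hol_off_const by (rule hol_off_mult)
  ultimately show ?case by blast
next
  case (add G H)
  obtain g where g: "hol_off K g" "\<And>w. w \<in> K \<Longrightarrow>
    continuous_on cube (\<lambda>(x, y, z). G (tri (ang (sqrt (bary 1 w)) x) (ang (sqrt (bary 2 w)) y) (ang (sqrt (bary 3 w)) z))) \<and>
    torus_mean G (sqrt (bary 1 w)) (sqrt (bary 2 w)) (sqrt (bary 3 w)) = g w" using add.IH(1) by blast
  obtain h where h: "hol_off K h" "\<And>w. w \<in> K \<Longrightarrow>
    continuous_on cube (\<lambda>(x, y, z). H (tri (ang (sqrt (bary 1 w)) x) (ang (sqrt (bary 2 w)) y) (ang (sqrt (bary 3 w)) z))) \<and>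
    torus_mean H (sqrt (bary 1 w)) (sqrt (bary 2 w)) (sqrt (bary 3 w)) = h w" using add.IH(2) by blast
  show ?case
  proof (intro exI[of _ "\<lambda>w. g w + h w"] conjI ballI)
    show "hol_off K (\<lambda>w. g w + h w)" using g(1) h(1) by (rule hol_off_add)
    fix w assume w: "w \<in> K"
    let ?T = "\<lambda>t. tri (ang (sqrt (bary 1 w)) (fst t)) (ang (sqrt (bary 2 w)) (fst (snd t))) (ang (sqrt (bary 3 w)) (snd (snd t)))"
    have c: "continuous_on cube (\<lambda>t. G (?T t))" "continuous_on cube (\<lambda>t. H (?T t))"
      using g(2)[OF w] h(2)[OF w] by (simp_all add: case_prod_unfold)
    then show "continuous_on cube (\<lambda>(x, y, z). G (tri (ang (sqrt (bary 1 w)) x) (ang (sqrt (bary 2 w)) y) (ang (sqrt (bary 3 w)) z)) +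
       H (tri (ang (sqrt (bary 1 w)) x) (ang (sqrt (bary 2 w)) y) (ang (sqrt (bary 3 w)) z)))"
      unfolding case_prod_unfold by (rule continuous_on_add)
    show "torus_mean (\<lambda>z. G z + H z) (sqrt (bary 1 w)) (sqrt (bary 2 w)) (sqrt (bary 3 w)) = g w + h w"
      using integral_add[OF integrable_continuous[OF c(1)] integrable_continuous[OF c(2)]] g(2)[OF w] h(2)[OF w]
      by (simp add: torus_mean_def case_prod_unfold)
  qed
qed

text \<open>The mean of \<open>G\<close> over the torus above \<open>w\<close> is a
  \<open>hol_off\<close> function of \<open>w\<close>, while \<open>g (wmap z)\<close> is constant
  there. A good approximation by \<open>G\<close> would therefore give one of \<open>g\<close> on
  \<open>K\<close>.\<close>

lemma leaf_fun_not_approx: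
  assumes "cheese K" "K \<subseteq> open_triangle"
  shows "\<exists>g e. continuous_on UNIV g \<and> e > 0 \<and>
    (\<forall>G. leaf_fun K G \<longrightarrow> (\<exists>z\<in>unit_sphere3. wmap z \<in> K \<and> e \<le> cmod (g (wmap z) - G z)))"
proof -
  obtain g e where g: "continuous_on UNIV g" "e > 0" "\<And>f. hol_off K f \<Longrightarrow> \<exists>w\<in>K. e \<le> cmod (f w - g w)"
    using assms(1) unfolding cheese_def by blast
  have "\<exists>z\<in>unit_sphere3. wmap z \<in> K \<and> e / 2 \<le> cmod (g (wmap z) - G z)" if G: "leaf_fun K G" for G
  proof (rule ccontr)
    assume neg: "\<not> ?thesis"
    obtain h where h: "hol_off K h" "\<And>w. w \<in> K \<Longrightarrow>
      continuous_on cube (\<lambda>(x, y, z). G (tri (ang (sqrt (bary 1 w)) x) (ang (sqrt (bary 2 w)) y) (ang (sqrt (bary 3 w)) z))) \<and>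
      torus_mean G (sqrt (bary 1 w)) (sqrt (bary 2 w)) (sqrt (bary 3 w)) = h w"
      using leaf_fun_mean[OF G assms(2)] by blast
    obtain w where w: "w \<in> K" "e \<le> cmod (h w - g w)" using g(3)[OF h(1)] by blast
    let ?T = "\<lambda>t. tri (ang (sqrt (bary 1 w)) (fst t)) (ang (sqrt (bary 2 w)) (fst (snd t))) (ang (sqrt (bary 3 w)) (snd (snd t)))"
    have pos: "0 < bary j w" for j using assms(2) w(1) by (auto simp: open_triangle_def)
    have T: "?T t \<in> unit_sphere3" "wmap (?T t) = w" for t
    proof -
      have "(norm (?T t))\<^sup>2 = 1" using pos less_imp_le[OF pos] sum_bary[of w] by (simp add: norm_sq_tri)
      then show "?T t \<in> unit_sphere3" using power2_eq_imp_eq[of "norm (?T t)" 1] by simp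
      show "wmap (?T t) = w" using less_imp_le[OF pos] by (simp add: wmap_def) (simp add: bary_def)
    qed
    have c: "continuous_on cube (\<lambda>t. G (?T t))"
      using h(2)[OF w(1)] by (simp add: case_prod_unfold)
    have "h w - g w = integral cube (\<lambda>t. G (?T t) - g w)"
      using h(2)[OF w(1)] integrable_continuous[OF c]
      by (subst integral_diff) (auto simp: torus_mean_def case_prod_unfold content_Pair)
    also have "cmod \<dots> \<le> (e / 2) * measure lborel cube"
    proof (rule integrable_bound)
      show "(\<lambda>t. G (?T t) - g w) integrable_on cube"
        by (intro integrable_continuous continuous_intros c)
      show "cmod (G (?T t) - g w) \<le> e / 2" for t
        using neg T[of t] w(1) by (force simp: norm_minus_commute)
    qed (use g in auto)
    finally show False using w(2) g(2) by (simp add: content_Pair)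
  qed
  then show ?thesis using g by (intro exI[of _ g] exI[of _ "e / 2"]) auto
qed

section \<open>The algebra\<close>

abbreviation "S3 \<equiv> unit_sphere3"

lemma compact_S3: "compact S3" by (rule compact_sphere)

lemma bounded_on_S3:
  fixes F :: "complex^3 \<Rightarrow> complex"
  assumes "continuous_on S3 F"
  shows "\<exists>M\<ge>0. \<forall>z\<in>S3. cmod (F z) \<le> M"
proof -
  have "bounded (F ` S3)"
    using compact_continuous_image[OF assms compact_S3] by (rule compact_imp_bounded)
  then obtain M where "\<forall>x\<in>F ` S3. cmod x \<le> M" by (auto simp: bounded_iff)
  then show ?thesis by (intro exI[of _ "max 0 M"]) (auto simp: le_max_iff_disj)
qed

context cheese_family
begin

text \<open>Stated for arbitrary representatives, so that sums and products need no restriction to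
  the sphere; \<open>alg\<close> passes to the extensional ones.\<close>

definition leafwise :: "(complex^3 \<Rightarrow> complex) \<Rightarrow> bool" where
  "leafwise F \<longleftrightarrow> continuous_on S3 F \<and>
     (\<forall>n. \<forall>e>0. \<exists>G. leaf_fun (Q n) G \<and> (\<forall>z\<in>S3. wmap z \<in> Q n \<longrightarrow> cmod (F z - G z) < e))"

definition alg :: "(complex^3 \<Rightarrow> complex) set" where
  "alg = {restrict F S3 | F. leafwise F}"

lemma leafwise_cong:
  assumes "leafwise F" "\<And>z. z \<in> S3 \<Longrightarrow> F z = G z"
  shows "leafwise G"
proof -
  have "continuous_on S3 G"
    using assms continuous_on_cong[of S3 S3 F G] by (simp add: leafwise_def)
  then show ?thesis using assms unfolding leafwise_def by metis
qed

lemma restrict_alg_iff: "restrict F S3 \<in> alg \<longleftrightarrow> leafwise F"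
proof
  assume "restrict F S3 \<in> alg"
  then obtain G where G: "leafwise G" "restrict F S3 = restrict G S3" by (auto simp: alg_def)
  have "F z = G z" if "z \<in> S3" for z using fun_cong[OF G(2), of z] that by simp
  then show "leafwise F" using leafwise_cong[OF G(1)] by simp
qed (auto simp: alg_def)

lemma leafwise_restrict [simp]: "leafwise (restrict F S3) \<longleftrightarrow> leafwise F"
  using leafwise_cong[of F "restrict F S3"] leafwise_cong[of "restrict F S3" F] by auto

lemma alg_iff: "F \<in> alg \<longleftrightarrow> F \<in> extensional S3 \<and> leafwise F"
proof
  assume "F \<in> alg"
  then show "F \<in> extensional S3 \<and> leafwise F"
    by (auto simp: alg_def)
next
  assume F: "F \<in> extensional S3 \<and> leafwise F"
  then have "restrict F S3 = F" by (simp add: extensional_restrict)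
  then show "F \<in> alg" using F restrict_alg_iff by metis
qed

lemma leafwise_continuous: "leafwise F \<Longrightarrow> continuous_on S3 F"
  by (simp add: leafwise_def)

lemma leafwiseI:
  assumes "continuous_on S3 F"
    "\<And>n. \<exists>G. leaf_fun (Q n) G \<and> (\<forall>z\<in>S3. wmap z \<in> Q n \<longrightarrow> F z = G z)"
  shows "leafwise F"
  unfolding leafwise_def
proof (intro conjI allI impI assms(1))
  fix n and e :: real assume "e > 0"
  obtain G where "leaf_fun (Q n) G" "\<forall>z\<in>S3. wmap z \<in> Q n \<longrightarrow> F z = G z" using assms(2) by blast
  then show "\<exists>G. leaf_fun (Q n) G \<and> (\<forall>z\<in>S3. wmap z \<in> Q n \<longrightarrow> cmod (F z - G z) < e)"
    using \<open>e > 0\<close> by (intro exI[of _ G]) auto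
qed

lemma leafwise_ball:
  assumes "continuous_on (cball 0 1) F" "holomorphic_on3 F (ball 0 1)"
  shows "leafwise F"
proof (rule leafwiseI)
  show "continuous_on S3 F" using assms(1) by (rule continuous_on_subset) auto
  show "\<exists>G. leaf_fun (Q n) G \<and> (\<forall>z\<in>S3. wmap z \<in> Q n \<longrightarrow> F z = G z)" for n
    using leaf_fun_ball[OF assms] by blast
qed

lemma leafwise_const: "leafwise (\<lambda>z. c)"
  by (rule leafwise_ball) (auto intro: holomorphic_on3_const)

lemma leafwise_nth: "leafwise (\<lambda>z. z $ j)"
  by (rule leafwise_ball) (auto intro: holomorphic_on3_nth continuous_intros)

lemma leafwise_add:
  assumes F: "leafwise F" and H: "leafwise H"
  shows "leafwise (\<lambda>z. F z + H z)"
  unfolding leafwise_def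
proof (intro conjI allI impI)
  show "continuous_on S3 (\<lambda>z. F z + H z)"
    using assms by (intro continuous_intros leafwise_continuous)
  fix n and e :: real assume e: "e > 0"
  obtain G where G: "leaf_fun (Q n) G" "\<And>z. z \<in> S3 \<Longrightarrow> wmap z \<in> Q n \<Longrightarrow> cmod (F z - G z) < e / 2"
    using F e half_gt_zero unfolding leafwise_def by metis
  obtain K where K: "leaf_fun (Q n) K" "\<And>z. z \<in> S3 \<Longrightarrow> wmap z \<in> Q n \<Longrightarrow> cmod (H z - K z) < e / 2"
    using H e half_gt_zero unfolding leafwise_def by metis
  have "cmod (F z + H z - (G z + K z)) < e" if z: "z \<in> S3" "wmap z \<in> Q n" for z
    using norm_diff_triangle_ineq[of "F z" "H z" "G z" "K z"] G(2)[OF z] K(2)[OF z] by linarith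
  then show "\<exists>G. leaf_fun (Q n) G \<and> (\<forall>z\<in>S3. wmap z \<in> Q n \<longrightarrow> cmod (F z + H z - G z) < e)"
    using leaf_fun.add[OF G(1) K(1)] by blast
qed

lemma leafwise_mult:
  assumes F: "leafwise F" and H: "leafwise H"
  shows "leafwise (\<lambda>z. F z * H z)"
  unfolding leafwise_def
proof (intro conjI allI impI)
  show "continuous_on S3 (\<lambda>z. F z * H z)"
    using assms by (intro continuous_intros leafwise_continuous)
  fix n and e :: real assume e: "e > 0"
  obtain M where M: "M \<ge> 0" "\<forall>z\<in>S3. cmod (F z) \<le> M"
    using bounded_on_S3[OF leafwise_continuous[OF F]] by blast
  obtain L where L: "L \<ge> 0" "\<forall>z\<in>S3. cmod (H z) \<le> L"
    using bounded_on_S3[OF leafwise_continuous[OF H]] by blast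
  \<comment> \<open>Errors below \<open>d\<close> in both factors cost at most
    \<open>d * (M + L + 1)\<close> in the product; the cap 1 bounds the approximant of
    \<open>H\<close> by \<open>L + 1\<close>.\<close>
  define d where "d = min 1 (e / (M + L + 2))"
  have pos: "M + L + 2 > 0" using M L by linarith
  have d: "d > 0" "d \<le> 1" using e pos by (auto simp: d_def)
  have "d \<le> e / (M + L + 2)" by (simp add: d_def)
  then have de: "d * (M + L + 2) \<le> e" using pos by (simp add: pos_le_divide_eq)
  obtain G where G: "leaf_fun (Q n) G" "\<And>z. z \<in> S3 \<Longrightarrow> wmap z \<in> Q n \<Longrightarrow> cmod (F z - G z) < d"
    using F d(1) unfolding leafwise_def by metis
  obtain K where K: "leaf_fun (Q n) K" "\<And>z. z \<in> S3 \<Longrightarrow> wmap z \<in> Q n \<Longrightarrow> cmod (H z - K z) < d"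
    using H d(1) unfolding leafwise_def by metis
  have "cmod (F z * H z - G z * K z) < e" if z: "z \<in> S3" "wmap z \<in> Q n" for z
  proof -
    have "F z * H z - G z * K z = F z * (H z - K z) + (F z - G z) * K z" by (simp add: algebra_simps)
    then have "cmod (F z * H z - G z * K z) \<le> cmod (F z) * cmod (H z - K z) + cmod (F z - G z) * cmod (K z)"
      by (metis norm_mult norm_triangle_ineq)
    also have "\<dots> \<le> M * d + d * (L + 1)"
    proof (intro add_mono mult_mono)
      have "cmod (K z) \<le> cmod (H z) + cmod (H z - K z)"
        by (metis norm_minus_commute norm_triangle_sub)
      then show "cmod (K z) \<le> L + 1" using L(2) z(1) K(2)[OF z] d(2) by force
    qed (use M L d G(2)[OF z] K(2)[OF z] z in \<open>auto simp: less_imp_le\<close>)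
    also have "\<dots> < d * (M + L + 2)" using d(1) by (simp add: algebra_simps)
    finally show ?thesis using de by linarith
  qed
  then show "\<exists>G. leaf_fun (Q n) G \<and> (\<forall>z\<in>S3. wmap z \<in> Q n \<longrightarrow> cmod (F z * H z - G z) < e)"
    using leaf_fun_mult[OF G(1) K(1)] by blast
qed

lemma leafwise_scale: "leafwise F \<Longrightarrow> leafwise (\<lambda>z. c * F z)"
  by (rule leafwise_mult[OF leafwise_const])

lemma leafwise_diff:
  assumes "leafwise F" "leafwise G"
  shows "leafwise (\<lambda>z. F z - G z)"
  using leafwise_add[OF assms(1) leafwise_scale[OF assms(2), of "- 1"]] by simp

lemma leafwise_power: "leafwise F \<Longrightarrow> leafwise (\<lambda>z. F z ^ k)"
  by (induction k) (auto intro: leafwise_const leafwise_mult)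

lemma leafwise_sum: "\<lbrakk>finite I; \<And>i. i \<in> I \<Longrightarrow> leafwise (F i)\<rbrakk> \<Longrightarrow> leafwise (\<lambda>z. \<Sum>i\<in>I. F i z)"
  by (induction I rule: finite_induct) (auto intro: leafwise_const leafwise_add)

lemma leafwise_uniform_limit:
  assumes g: "\<And>k::nat. leafwise (g k)" and F: "continuous_on S3 F" and lim: "uniform_limit S3 g F sequentially"
  shows "leafwise F"
  unfolding leafwise_def
proof (intro conjI allI impI F)
  fix n and e :: real assume e: "e > 0"
  have "\<exists>k. \<forall>j\<ge>k. \<forall>z\<in>S3. dist (g j z) (F z) < e / 2"
    using uniform_limitD[OF lim, of "e / 2"] e unfolding eventually_sequentially by simp
  then obtain k where k: "\<And>z. z \<in> S3 \<Longrightarrow> dist (g k z) (F z) < e / 2" by blast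
  obtain G where G: "leaf_fun (Q n) G" "\<And>z. z \<in> S3 \<Longrightarrow> wmap z \<in> Q n \<Longrightarrow> cmod (g k z - G z) < e / 2"
    using g[of k] e half_gt_zero unfolding leafwise_def by metis
  have "cmod (F z - G z) < e" if z: "z \<in> S3" "wmap z \<in> Q n" for z
  proof -
    have "cmod (F z - g k z) < e / 2" using k[OF z(1)] by (simp add: dist_norm norm_minus_commute)
    then show ?thesis using G(2)[OF z] norm_triangle_ineq[of "F z - g k z" "g k z - G z"] by simp
  qed
  then show "\<exists>G. leaf_fun (Q n) G \<and> (\<forall>z\<in>S3. wmap z \<in> Q n \<longrightarrow> cmod (F z - G z) < e)"
    using G(1) by blast
qed

lemma leafwise_torus_act:
  assumes "leafwise F"
  shows "leafwise (\<lambda>z. F (torus_act t z))"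
  unfolding leafwise_def
proof (intro conjI allI impI)
  show "continuous_on S3 (\<lambda>z. F (torus_act t z))"
    by (rule continuous_on_compose2[OF leafwise_continuous[OF assms] continuous_on_torus_act]) auto
  fix n and e :: real assume e: "e > 0"
  obtain G where G: "leaf_fun (Q n) G" "\<And>z. z \<in> S3 \<Longrightarrow> wmap z \<in> Q n \<Longrightarrow> cmod (F z - G z) < e"
    using assms e unfolding leafwise_def by metis
  have "cmod (F (torus_act t z) - G (torus_act t z)) < e" if "z \<in> S3" "wmap z \<in> Q n" for z
    using that by (intro G(2)) auto
  then show "\<exists>G. leaf_fun (Q n) G \<and> (\<forall>z\<in>S3. wmap z \<in> Q n \<longrightarrow> cmod (F (torus_act t z) - G z) < e)"
    using leaf_fun_torus_act[OF G(1), of t] by blast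
qed

lemma uniform_algebra_alg: "uniform_algebra S3 alg"
  unfolding uniform_algebra_def
proof (intro conjI ballI allI impI; (elim conjE)?)
  show "compact S3" by (rule compact_S3)
  show "alg \<subseteq> cont_funs S3" by (auto simp: cont_funs_def alg_iff leafwise_continuous)
  show "(\<lambda>x\<in>S3. f x + g x) \<in> alg" if "f \<in> alg" "g \<in> alg" for f g
    using that by (simp add: restrict_alg_iff alg_iff leafwise_add)
  show "(\<lambda>x\<in>S3. f x * g x) \<in> alg" if "f \<in> alg" "g \<in> alg" for f g
    using that by (simp add: restrict_alg_iff alg_iff leafwise_mult)
  show "(\<lambda>x\<in>S3. c * f x) \<in> alg" if "f \<in> alg" for f c
    using that by (simp add: restrict_alg_iff alg_iff leafwise_scale)
  show "(\<lambda>x\<in>S3. c) \<in> alg" for c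
    by (simp add: restrict_alg_iff leafwise_const)
  show "f \<in> alg" if "f \<in> cont_funs S3" "\<forall>n. g n \<in> alg" "uniform_limit S3 g f sequentially" for f g
    using that leafwise_uniform_limit[of g f] by (simp add: alg_iff cont_funs_def)
  show "\<exists>f\<in>alg. f x \<noteq> f y" if xy: "x \<in> S3" "y \<in> S3" "x \<noteq> y" for x y
  proof -
    obtain j where "x $ j \<noteq> y $ j" using xy(3) by (auto simp: vec_eq_iff)
    then show ?thesis
      using xy leafwise_nth[of j] by (intro bexI[of _ "restrict (\<lambda>z. z $ j) S3"]) (auto simp: restrict_alg_iff)
  qed
qed

lemma ball_algebra_subset: "ball_algebra3 \<subseteq> alg"
  by (auto simp: ball_algebra3_def restrict_alg_iff leafwise_ball)

lemma torus_invariant_alg: "torus_invariant alg"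
  unfolding torus_invariant_def by (simp add: restrict_alg_iff alg_iff leafwise_torus_act)

text \<open>The source of the functions used against a character. On a cheese \<open>u\<close> is
  constant; if the constant is not 0, the cheese lies in \<open>V\<close>, away from the
  singularities, and the function is a single generator there. Continuity is glued from the part
  over \<open>V\<close> and an open part where \<open>u\<close> vanishes.\<close>

lemma leafwise_cutoff:
  assumes u: "Qconst u" "closure {w. u w \<noteq> 0} \<subseteq> V" and V: "open V"
    and f: "finite pts" "f holomorphic_on - pts" "V \<subseteq> - pts"
    and k: "k > 0 \<Longrightarrow> V \<subseteq> {w. 0 < bary j w}"
  shows "leafwise (\<lambda>z. of_real (u (wmap z)) * f (wmap z) / (z $ j) ^ k)"
proof (rule leafwiseI)
  let ?F = "\<lambda>z. of_real (u (wmap z)) * f (wmap z) / (z $ j) ^ k"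
  have nz: "(z $ j) ^ k \<noteq> 0" if "z \<in> S3" "wmap z \<in> V" for z
    using k that bary_wmap[OF that(1), of j] by (cases "k = 0") auto
  let ?A = "S3 \<inter> wmap -` V" and ?B = "S3 \<inter> wmap -` (- closure {w. u w \<noteq> 0})"
  have cw: "continuous_on S wmap" for S by (intro continuous_intros)
  have "?A \<union> ?B = S3" using u(2) by auto
  have op: "openin (top_of_set S3) ?A" "openin (top_of_set S3) ?B"
    using V by (auto intro!: continuous_openin_preimage_gen cw)
  have cu: "continuous_on S u" for S
    using u(1) continuous_on_subset unfolding Qconst_def by blast
  have "continuous_on ?A ?F"
  proof (intro continuous_on_divide continuous_on_mult continuous_on_of_real)
    show "continuous_on ?A (\<lambda>z. u (wmap z))"
      by (rule continuous_on_compose2[OF cu[of UNIV] cw]) auto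
    have "continuous_on (- pts) f" using f(2) by (rule holomorphic_on_imp_continuous_on)
    then show "continuous_on ?A (\<lambda>z. f (wmap z))"
      by (rule continuous_on_compose2[OF _ cw]) (use f(3) in auto)
    show "continuous_on ?A (\<lambda>z. (z $ j) ^ k)" by (intro continuous_intros)
  qed (use nz in auto)
  moreover have "continuous_on ?B ?F"
  proof -
    have "?F z = 0" if "z \<in> ?B" for z
    proof -
      have "wmap z \<notin> {w. u w \<noteq> 0}" using that closure_subset[of "{w. u w \<noteq> 0}"] by blast
      then show ?thesis by simp
    qed
    then have "continuous_on ?B ?F \<longleftrightarrow> continuous_on ?B (\<lambda>_. 0 :: complex)"
      by (rule continuous_on_cong[OF refl])
    then show ?thesis by simp
  qed
  ultimately show "continuous_on S3 ?F"
    using continuous_on_Un_local_open[of ?A ?B ?F] op \<open>?A \<union> ?B = S3\<close> by simp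
  fix n
  show "\<exists>G. leaf_fun (Q n) G \<and> (\<forall>z\<in>S3. wmap z \<in> Q n \<longrightarrow> ?F z = G z)"
  proof (cases "\<forall>w\<in>Q n. u w = 0")
    case True
    then show ?thesis using leaf_fun_const[of "Q n" 0] by (intro exI[of _ "\<lambda>_. 0"]) auto
  next
    case False
    then obtain w0 where w0: "w0 \<in> Q n" "u w0 \<noteq> 0" by blast
    define c where "c = u w0"
    have u0: "u w = c" if "w \<in> Q n" for w
      using u(1) w0(1) that unfolding Qconst_def c_def by blast
    have "c \<noteq> 0" using w0(2) by (simp add: c_def)
    then have "Q n \<subseteq> {w. u w \<noteq> 0}" using u0 by auto
    then have "Q n \<subseteq> V" using u(2) closure_subset[of "{w. u w \<noteq> 0}"] by blast
    then have "pts \<inter> Q n = {}" using f(3) by blast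
    then have "hol_off (Q n) f" by (rule hol_offI[OF f(2,1)])
    then have *: "leaf_fun (Q n) (\<lambda>z. of_real c * f (wmap z) / (z$1 ^ a1 * z$2 ^ a2 * z$3 ^ a3))" for a1 a2 a3
      by (intro leaf_fun.base holomorphic_on3_const continuous_on_const)
    have "leaf_fun (Q n) (\<lambda>z. of_real c * f (wmap z) / (z $ j) ^ k)"
      using *[of k 0 0] *[of 0 k 0] *[of 0 0 k] exhaust_3[of j] by auto
    then show ?thesis using u0 by (intro exI[of _ "\<lambda>z. of_real c * f (wmap z) / (z $ j) ^ k"]) simp
  qed
qed

lemma Qconst_const: "Qconst (\<lambda>_. c)"
  by (simp add: Qconst_def)

lemma Qconst_comp2:
  assumes "Qconst u" "Qconst v" "continuous_on UNIV (\<lambda>p. h (fst p) (snd p))"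
  shows "Qconst (\<lambda>w. h (u w) (v w))"
proof -
  have "continuous_on UNIV (\<lambda>w. (u w, v w))"
    using assms by (intro continuous_intros) (auto simp: Qconst_def)
  then have "continuous_on UNIV (\<lambda>w. h (u w) (v w))"
    using continuous_on_compose2[OF assms(3), of UNIV "\<lambda>w. (u w, v w)"] by simp
  moreover have "h (u x) (v x) = h (u y) (v y)" if "x \<in> Q n" "y \<in> Q n" for n x y
  proof -
    have "u x = u y" "v x = v y" using assms that unfolding Qconst_def by blast+
    then show ?thesis by simp
  qed
  ultimately show ?thesis unfolding Qconst_def by blast
qed

lemma leafwise_Qconst:
  assumes "Qconst u"
  shows "leafwise (\<lambda>z. of_real (u (wmap z)))"
  using leafwise_cutoff[OF assms, of UNIV "{}" "\<lambda>_. 1" 0] by simp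

lemma leafwise_wmap: "leafwise wmap"
  using leafwise_cutoff[OF Qconst_const[of 1], of UNIV "{}" "\<lambda>w. w" 0] by simp

end

section \<open>Characters\<close>

locale alg_character = cheese_family +
  fixes \<phi> :: "(complex^3 \<Rightarrow> complex) \<Rightarrow> complex"
  assumes mlf: "mult_lin_functional S3 alg \<phi>" and nonzero: "\<exists>f\<in>alg. \<phi> f \<noteq> 0"
begin

definition \<psi> :: "(complex^3 \<Rightarrow> complex) \<Rightarrow> complex" where
  "\<psi> F = \<phi> (restrict F S3)"

lemma psi_cong: "(\<And>z. z \<in> S3 \<Longrightarrow> F z = G z) \<Longrightarrow> \<psi> F = \<psi> G"
  unfolding \<psi>_def by (metis restrict_ext)

lemma psi_add:
  assumes "leafwise F" "leafwise G"
  shows "\<psi> (\<lambda>z. F z + G z) = \<psi> F + \<psi> G"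
proof -
  have "\<phi> (\<lambda>x\<in>S3. restrict F S3 x + restrict G S3 x) = \<phi> (restrict F S3) + \<phi> (restrict G S3)"
    using mlf assms unfolding mult_lin_functional_def restrict_alg_iff[symmetric] by blast
  moreover have "(\<lambda>x\<in>S3. restrict F S3 x + restrict G S3 x) = (\<lambda>x\<in>S3. F x + G x)"
    by (rule restrict_ext) simp
  ultimately show ?thesis by (simp add: \<psi>_def)
qed

lemma psi_mult:
  assumes "leafwise F" "leafwise G"
  shows "\<psi> (\<lambda>z. F z * G z) = \<psi> F * \<psi> G"
proof -
  have "\<phi> (\<lambda>x\<in>S3. restrict F S3 x * restrict G S3 x) = \<phi> (restrict F S3) * \<phi> (restrict G S3)"
    using mlf assms unfolding mult_lin_functional_def restrict_alg_iff[symmetric] by blast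
  moreover have "(\<lambda>x\<in>S3. restrict F S3 x * restrict G S3 x) = (\<lambda>x\<in>S3. F x * G x)"
    by (rule restrict_ext) simp
  ultimately show ?thesis by (simp add: \<psi>_def)
qed

lemma psi_scale:
  assumes "leafwise F"
  shows "\<psi> (\<lambda>z. c * F z) = c * \<psi> F"
proof -
  have "\<phi> (\<lambda>x\<in>S3. c * restrict F S3 x) = c * \<phi> (restrict F S3)"
    using mlf assms unfolding mult_lin_functional_def restrict_alg_iff[symmetric] by blast
  moreover have "(\<lambda>x\<in>S3. c * restrict F S3 x) = (\<lambda>x\<in>S3. c * F x)"
    by (rule restrict_ext) simp
  ultimately show ?thesis by (simp add: \<psi>_def)
qed

lemma psi_diff:
  assumes "leafwise F" "leafwise G"
  shows "\<psi> (\<lambda>z. F z - G z) = \<psi> F - \<psi> G"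
  using psi_add[OF assms(1) leafwise_scale[OF assms(2), of "- 1"]] psi_scale[OF assms(2), of "- 1"] by simp

lemma psi_one: "\<psi> (\<lambda>z. 1) = 1"
proof -
  obtain f where f: "f \<in> alg" "\<phi> f \<noteq> 0" using nonzero by blast
  have fr: "restrict f S3 = f" "leafwise f" using f(1) by (auto simp: alg_iff extensional_restrict)
  have "\<psi> f = \<psi> f * \<psi> (\<lambda>z. 1)"
    using psi_mult[OF fr(2) leafwise_const[of 1]] by simp
  moreover have "\<psi> f \<noteq> 0" using f(2) fr(1) by (simp add: \<psi>_def)
  ultimately show ?thesis by simp
qed

lemma psi_const: "\<psi> (\<lambda>z. c) = c"
  using psi_scale[OF leafwise_const[of 1], of c] psi_one by simp

lemma psi_power: "leafwise F \<Longrightarrow> \<psi> (\<lambda>z. F z ^ k) = \<psi> F ^ k"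
  by (induction k) (simp_all add: psi_one psi_mult leafwise_power)

lemma psi_sum:
  "\<lbrakk>finite I; \<And>i. i \<in> I \<Longrightarrow> leafwise (F i)\<rbrakk> \<Longrightarrow> \<psi> (\<lambda>z. \<Sum>i\<in>I. F i z) = (\<Sum>i\<in>I. \<psi> (F i))"
  by (induction I rule: finite_induct) (simp_all add: psi_const psi_add leafwise_sum)

text \<open>If the value exceeded the bound, a geometric series would invert an element of the kernel.\<close>

lemma psi_bound:
  assumes F: "leafwise F" and B: "B \<ge> 0" "\<And>z. z \<in> S3 \<Longrightarrow> cmod (F z) \<le> B"
  shows "cmod (\<psi> F) \<le> B"
proof (rule ccontr)
  assume "\<not> cmod (\<psi> F) \<le> B"
  then have c: "cmod (\<psi> F) > B" by simp
  define c where "c = \<psi> F"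
  define a where "a z = inverse c * F z" for z
  define q where "q = B / cmod c"
  have cc: "cmod c > B" "c \<noteq> 0" using c B(1) by (auto simp: c_def)
  have q: "0 \<le> q" "q < 1" using cc B(1) by (auto simp: q_def divide_less_eq_1)
  have a: "leafwise a" unfolding a_def using F by (rule leafwise_scale)
  have psia: "\<psi> a = 1"
    unfolding a_def using psi_scale[OF F, of "inverse c"] cc(2) by (simp add: c_def)
  have aq: "cmod (a z) \<le> q" if "z \<in> S3" for z
  proof -
    have "cmod (a z) = cmod (F z) / cmod c"
      by (simp add: a_def norm_mult norm_inverse divide_inverse mult.commute)
    then show ?thesis unfolding q_def using B(2)[OF that] by (simp add: divide_right_mono)
  qed
  have a1: "a z \<noteq> 1" if "z \<in> S3" for z using aq[OF that] q by auto
  define s where "s k z = (\<Sum>i<k. a z ^ i)" for k :: nat and z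
  define b where "b z = 1 / (1 - a z)" for z
  have s: "leafwise (s k)" for k
    unfolding s_def using a by (intro leafwise_sum leafwise_power) auto
  have cb: "continuous_on S3 b"
    unfolding b_def using leafwise_continuous[OF a] a1 by (intro continuous_intros) auto
  have ul: "uniform_limit S3 s b sequentially"
  proof (rule uniform_limitI)
    fix e :: real assume e: "e > 0"
    have "(\<lambda>k. q ^ k / (1 - q)) \<longlonglongrightarrow> 0 / (1 - q)"
      using q by (intro tendsto_intros LIMSEQ_power_zero) auto
    then have "eventually (\<lambda>k. q ^ k / (1 - q) < e) sequentially"
      using e by (intro order_tendstoD(2)) auto
    then show "\<forall>\<^sub>F k in sequentially. \<forall>z\<in>S3. dist (s k z) (b z) < e"
    proof (rule eventually_mono, intro ballI)
      fix k z assume k: "q ^ k / (1 - q) < e" and z: "z \<in> S3"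
      have "s k z - b z = - (a z ^ k / (1 - a z))"
        using a1[OF z] by (simp add: s_def b_def sum_gp_strict diff_divide_distrib)
      then have "dist (s k z) (b z) = cmod (a z) ^ k / cmod (1 - a z)"
        by (simp add: dist_norm norm_divide norm_power)
      also have "\<dots> \<le> q ^ k / (1 - q)"
      proof (intro frac_le power_mono)
        show "1 - q \<le> cmod (1 - a z)"
          using norm_triangle_ineq2[of 1 "a z"] aq[OF z] by simp
      qed (use aq[OF z] q in auto)
      finally show "dist (s k z) (b z) < e" using k by simp
    qed
  qed
  have b: "leafwise b" by (rule leafwise_uniform_limit[of s, OF s cb ul])
  have d: "leafwise (\<lambda>z. 1 - a z)" "\<psi> (\<lambda>z. 1 - a z) = 0"
    using leafwise_diff[OF leafwise_const a] psi_diff[OF leafwise_const a, of 1] psi_one psia by auto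
  have "\<psi> (\<lambda>z. 1) = \<psi> (\<lambda>z. b z * (1 - a z))"
    using a1 by (intro psi_cong) (auto simp: b_def)
  then show False using psi_mult[OF b d(1)] d(2) psi_one by simp
qed

text \<open>If every point \<open>s\<close> failed for some \<open>U s\<close>, the kernel would
  contain a nonnegative function positive at \<open>s\<close>. By compactness a finite sum of these
  is positive over the whole sphere, hence invertible in the algebra.\<close>

lemma Qconst_value:
  "\<exists>s0. \<forall>u. Qconst u \<longrightarrow> \<psi> (\<lambda>z. of_real (u (wmap z))) = of_real (u s0)"
proof (rule ccontr)
  assume "\<not> ?thesis"
  then obtain U where U: "\<And>s. Qconst (U s)" "\<And>s. \<psi> (\<lambda>z. of_real (U s (wmap z))) \<noteq> of_real (U s s)"
    by metis
  define c where "c s = \<psi> (\<lambda>z. of_real (U s (wmap z)))" for s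
  \<comment> \<open>Equals \<open>(U s - c s) * (U s - cnj (c s))\<close>, as \<open>U s\<close> is
    real-valued; the first factor is in the kernel.\<close>
  define p where "p s w = (U s w - Re (c s))\<^sup>2 + (Im (c s))\<^sup>2" for s w
  have Qp: "Qconst (p s)" for s
    unfolding p_def
    by (rule Qconst_comp2[OF U(1) Qconst_const[of 0], where h="\<lambda>x y. (x - Re (c s))\<^sup>2 + (Im (c s))\<^sup>2"])
       (intro continuous_intros)
  have pnn: "p s w \<ge> 0" for s w by (simp add: p_def)
  have ppos: "p s s > 0" for s
  proof -
    have "c s \<noteq> of_real (U s s)" using U(2)[of s] by (simp add: c_def)
    then have "U s s - Re (c s) \<noteq> 0 \<or> Im (c s) \<noteq> 0" by (auto simp: complex_eq_iff)
    then show ?thesis unfolding p_def by (auto simp: sum_power2_gt_zero_iff)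
  qed
  have psip: "\<psi> (\<lambda>z. of_real (p s (wmap z))) = 0" for s
  proof -
    have u: "leafwise (\<lambda>z. of_real (U s (wmap z)))" using U(1) by (rule leafwise_Qconst)
    have l: "leafwise (\<lambda>z. of_real (U s (wmap z)) - k)" for k
      using u leafwise_const by (rule leafwise_diff)
    have "\<psi> (\<lambda>z. of_real (p s (wmap z))) =
        \<psi> (\<lambda>z. (of_real (U s (wmap z)) - c s) * (of_real (U s (wmap z)) - cnj (c s)))"
      by (rule psi_cong) (simp add: p_def complex_eq_iff power2_eq_square algebra_simps)
    also have "\<dots> = \<psi> (\<lambda>z. of_real (U s (wmap z)) - c s) * \<psi> (\<lambda>z. of_real (U s (wmap z)) - cnj (c s))"
      by (rule psi_mult[OF l l])
    also have "\<psi> (\<lambda>z. of_real (U s (wmap z)) - c s) = 0"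
      unfolding psi_diff[OF u leafwise_const] psi_const by (simp add: c_def)
    finally have "\<psi> (\<lambda>z. of_real (p s (wmap z))) = 0 * \<psi> (\<lambda>z. of_real (U s (wmap z)) - cnj (c s))" .
    then show ?thesis by simp
  qed
  have comp: "compact (wmap ` S3)"
    by (intro compact_continuous_image compact_S3 continuous_intros)
  have cp: "continuous_on UNIV (p s)" for s using Qp by (simp add: Qconst_def)
  have op: "open {w. 0 < p s w}" for s
    by (intro open_Collect_less continuous_on_const cp)
  obtain D where D: "D \<subseteq> UNIV" "finite D" "wmap ` S3 \<subseteq> (\<Union>s\<in>D. {w. 0 < p s w})"
  proof (rule compactE_image[OF comp, of UNIV "\<lambda>s. {w. 0 < p s w}"])
    show "wmap ` S3 \<subseteq> (\<Union>s\<in>UNIV. {w. 0 < p s w})" using ppos by blast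
  qed (use op in auto)
  define P where "P w = (\<Sum>s\<in>D. p s w)" for w
  have QP: "Qconst P"
    unfolding P_def using D(2)
  proof (induction D rule: finite_induct)
    case (insert s D)
    have "Qconst (\<lambda>w. p s w + (\<Sum>s\<in>D. p s w))"
      by (rule Qconst_comp2[OF Qp insert.IH, where h="(+)"]) (intro continuous_intros)
    then show ?case using insert by simp
  qed (simp add: Qconst_const)
  have Ppos: "P (wmap z) > 0" if z: "z \<in> S3" for z
  proof -
    obtain s where s: "s \<in> D" "0 < p s (wmap z)" using D(3) z by blast
    then show ?thesis unfolding P_def using D(2) pnn by (intro sum_pos2[of D s]) auto
  qed
  have psiP: "\<psi> (\<lambda>z. of_real (P (wmap z))) = 0"
    using psi_sum[OF D(2), of "\<lambda>s z. of_real (p s (wmap z))"] leafwise_Qconst[OF Qp] psip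
    by (simp add: P_def)
  have S3ne: "S3 \<noteq> {}" by simp
  have "continuous_on (wmap ` S3) P" using QP continuous_on_subset unfolding Qconst_def by blast
  then obtain x where x: "x \<in> wmap ` S3" "\<forall>y\<in>wmap ` S3. P x \<le> P y"
    using continuous_attains_inf[OF comp] S3ne by blast
  define m where "m = P x"
  have m: "m > 0" "\<And>z. z \<in> S3 \<Longrightarrow> m \<le> P (wmap z)" using x Ppos by (auto simp: m_def)
  \<comment> \<open>The maximum with \<open>m\<close> makes the reciprocal continuous on the whole
    plane and changes nothing over the sphere.\<close>
  have Qv: "Qconst (\<lambda>w. 1 / max (P w) m)"
    by (rule Qconst_comp2[OF QP Qconst_const[of m], where h="\<lambda>x y. 1 / max x m"])
       (intro continuous_intros, use m(1) in \<open>auto simp: max_def split: if_splits\<close>)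
  have "\<psi> (\<lambda>z. 1) = \<psi> (\<lambda>z. of_real (1 / max (P (wmap z)) m) * of_real (P (wmap z)))"
    using m Ppos by (intro psi_cong) (force simp: max_def)
  then show False
    using psi_mult[OF leafwise_Qconst[OF Qv] leafwise_Qconst[OF QP]] psiP psi_one by simp
qed

text \<open>\<open>E\<close> is the class of a point \<open>s0\<close> that represents the character
  on functions constant on cheeses, whereas \<open>s\<close> is its value at \<open>wmap\<close>. If
  \<open>s\<close> were outside \<open>E\<close>, a cutoff equal to 1 on \<open>E\<close> and
  vanishing near \<open>s\<close> would be a multiple of \<open>wmap z - s\<close> and have value 0
  instead of 1.\<close>

lemma leaf_point:
  "\<exists>s E. s \<in> E \<and> closed E \<and> saturated E \<and> ((\<exists>n. E = Q n) \<or> E = {s}) \<and> \<psi> wmap = s \<and>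
     (\<forall>u. Qconst u \<and> (\<forall>x\<in>E. u x = 1) \<longrightarrow> \<psi> (\<lambda>z. of_real (u (wmap z))) = 1)"
proof -
  obtain s0 where s0: "\<And>u. Qconst u \<Longrightarrow> \<psi> (\<lambda>z. of_real (u (wmap z))) = of_real (u s0)"
    using Qconst_value by blast
  define E where "E = sat {s0}"
  have E: "closed E" "saturated E" "s0 \<in> E"
    unfolding E_def by (simp_all add: closed_sat saturated_sat) (simp add: sat_def)
  have one: "\<psi> (\<lambda>z. of_real (u (wmap z))) = 1" if "Qconst u" "\<forall>x\<in>E. u x = 1" for u
    using s0[OF that(1)] that(2) E(3) by simp
  have s: "\<psi> wmap \<in> E"
  proof (rule ccontr)
    assume ns: "\<psi> wmap \<notin> E"
    let ?s = "\<psi> wmap"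
    obtain u where u: "Qconst u" "\<forall>x\<in>E. u x = 1" "closure {x. u x \<noteq> 0} \<subseteq> - {?s}"
      using cutoff[OF E(1,2), of "- {?s}"] ns by auto
    have us: "u ?s = 0" using u(3) closure_subset[of "{x. u x \<noteq> 0}"] by blast
    \<comment> \<open>Division by \<open>wmap z - \<psi> wmap\<close> is legitimate because
      \<open>u\<close> vanishes near that value; the zeroth power only matches the form of
      \<open>leafwise_cutoff\<close>.\<close>
    have G: "leafwise (\<lambda>z. of_real (u (wmap z)) * (1 / (wmap z - ?s)) / (z $ 1) ^ 0)"
      by (rule leafwise_cutoff[OF u(1,3), of "{?s}" "\<lambda>w. 1 / (w - ?s)"]) (auto intro!: holomorphic_intros)
    have W: "leafwise (\<lambda>z. wmap z - ?s)" "\<psi> (\<lambda>z. wmap z - ?s) = 0"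
      using leafwise_diff[OF leafwise_wmap leafwise_const, of ?s] psi_diff[OF leafwise_wmap leafwise_const, of ?s]
      by (simp_all add: psi_const)
    have "\<psi> (\<lambda>z. of_real (u (wmap z))) =
        \<psi> (\<lambda>z. of_real (u (wmap z)) * (1 / (wmap z - ?s)) / (z $ 1) ^ 0 * (wmap z - ?s))"
      using us by (intro psi_cong) (auto simp: divide_simps)
    then show False using psi_mult[OF G W(1)] W(2) one[OF u(1,2)] by simp
  qed
  have "(\<exists>n. E = Q n) \<or> E = {\<psi> wmap}"
  proof (cases "\<exists>n. s0 \<in> Q n")
    case True
    then obtain n where n: "s0 \<in> Q n" by blast
    have uniq: "m = n" if "s0 \<in> Q m" for m using that n Q_disj[of m n] by blast
    have "E \<subseteq> Q n"
    proof
      fix x assume "x \<in> E"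
      then have "x = s0 \<or> (\<exists>m. x \<in> Q m \<and> s0 \<in> Q m)" unfolding E_def sat_def by blast
      then show "x \<in> Q n" using uniq n by metis
    qed
    moreover have "Q n \<subseteq> E" using E(2,3) n unfolding saturated_def by blast
    ultimately show ?thesis by blast
  next
    case False
    then have "E = {s0}" unfolding E_def sat_def by blast
    then show ?thesis using s by simp
  qed
  then show ?thesis using s E(1,2) one by blast
qed

text \<open>With \<open>f\<close> from the Jensen property for \<open>l\<close>, which is
  \<open>L * |z_j|\<close> over the sphere, the function \<open>u * f / z_j ^ k\<close> is bounded
  by \<open>L ^ k\<close>, while its product with \<open>z_j ^ k\<close> has value 1 under the
  character. Taking \<open>k\<close>-th roots gives the claim.\<close>

lemma jensen_bound:
  assumes s: "s \<in> E" and E: "closed E" "saturated E" "jensen_trivial E" and w: "\<psi> wmap = s"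
    and one: "\<And>u. Qconst u \<Longrightarrow> \<forall>x\<in>E. u x = 1 \<Longrightarrow> \<psi> (\<lambda>z. of_real (u (wmap z))) = 1"
    and pos: "\<And>x. x \<in> E \<Longrightarrow> 0 < bary j x"
    and L: "0 < L" "L * sqrt (bary j s) > 1"
  shows "1 \<le> L * cmod (\<psi> (\<lambda>z. z $ j))"
proof -
  define l where "l w = L * sqrt (bary j w)" for w
  have cl: "continuous_on S l" for S
    unfolding l_def by (intro continuous_intros)
  have lpos: "\<forall>w\<in>E. 0 < l w" using pos L(1) by (simp add: l_def)
  have ls: "1 < l s" using L(2) by (simp add: l_def)
  obtain k f where kf: "hol_off E f" "f s = 1" "\<forall>w\<in>E. cmod (f w) < l w ^ k"
    using E(3) s cl lpos ls unfolding jensen_trivial_def by blast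
  \<comment> \<open>For \<open>k = 0\<close> the bound at \<open>s\<close> would read
    \<open>1 < 1\<close>.\<close>
  have k0: "k > 0" using kf(2,3) s by (cases k) auto
  obtain pts where pts: "finite pts" "pts \<inter> E = {}" "f holomorphic_on - pts"
    using kf(1) by (auto simp: hol_off_def)
  have opts: "open (- pts)" using pts(1) by (intro open_Compl finite_imp_closed)
  have cf: "continuous_on (- pts) f" using pts(3) by (rule holomorphic_on_imp_continuous_on)
  \<comment> \<open>The strict inequality persists on an open set around \<open>E\<close>, in which
    the cutoff can be supported.\<close>
  define V where "V = {w. 0 < bary j w} \<inter> (- pts \<inter> (\<lambda>w. l w ^ k - cmod (f w)) -` {0<..})"
  have o1: "open (- pts \<inter> (\<lambda>w. l w ^ k - cmod (f w)) -` {0<..})"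
    by (intro continuous_open_preimage[OF _ opts] continuous_intros cf cl)
  have "open {w. 0 < bary j w}" by (intro open_Collect_less continuous_intros)
  then have oV: "open V" unfolding V_def using o1 by (rule open_Int)
  have EV: "E \<subseteq> V" using pos kf(3) pts(2) by (auto simp: V_def)
  have Vp: "V \<subseteq> - pts" "V \<subseteq> {w. 0 < bary j w}" by (auto simp: V_def)
  obtain u where u: "Qconst u" "\<forall>x. 0 \<le> u x \<and> u x \<le> 1" "\<forall>x\<in>E. u x = 1" "closure {x. u x \<noteq> 0} \<subseteq> V"
    using cutoff[OF E(1,2) oV EV] by blast
  have G: "leafwise (\<lambda>z. of_real (u (wmap z)) * f (wmap z) / (z $ j) ^ k)"
    using leafwise_cutoff[OF u(1,4) oV pts(1,3) Vp(1)] Vp(2) by blast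
  have H: "leafwise (\<lambda>z. of_real (u (wmap z)) * h (wmap z))" if "h holomorphic_on - pts" for h
    using leafwise_cutoff[OF u(1,4) oV pts(1) that Vp(1), of 0] by simp
  have lz: "l (wmap z) = L * cmod (z $ j)" if "z \<in> S3" for z
    using bary_wmap[OF that, of j] by (simp add: l_def)
  have Gb: "cmod (of_real (u (wmap z)) * f (wmap z) / (z $ j) ^ k) \<le> L ^ k" if z: "z \<in> S3" for z
  proof (cases "u (wmap z) = 0")
    case False
    then have "wmap z \<in> V" using u(4) closure_subset[of "{x. u x \<noteq> 0}"] by blast
    then have b: "0 < bary j (wmap z)" "cmod (f (wmap z)) < (L * cmod (z $ j)) ^ k"
      by (auto simp: V_def lz[OF z])
    have zj: "cmod (z $ j) > 0" using b(1) bary_wmap[OF z, of j] by (cases "z $ j = 0") auto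
    have "u (wmap z) * cmod (f (wmap z)) \<le> 1 * (L * cmod (z $ j)) ^ k"
      using u(2) b(2) by (intro mult_mono) auto
    then show ?thesis
      using zj u(2) by (simp add: norm_mult norm_divide norm_power power_mult_distrib pos_divide_le_eq)
  qed (use L in simp)
  \<comment> \<open>The difference quotient with its removable singularity filled in. Then
    \<open>f = 1 + q * (w - s)\<close>, and \<open>w - s\<close> has value 0, so
    \<open>u * f\<close> has the same value as \<open>u\<close>.\<close>
  define q where "q w = (if w = s then deriv f s else (f w - f s) / (w - s))" for w
  have "s \<in> interior (- pts)" using opts s pts(2) by (auto simp: interior_open)
  then have hq: "q holomorphic_on - pts" unfolding q_def using pole_lemma[OF pts(3)] by simp
  have fq: "f w = 1 + q w * (w - s)" for w using kf(2) by (simp add: q_def)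
  have U: "leafwise (\<lambda>z. of_real (u (wmap z)))" using u(1) by (rule leafwise_Qconst)
  have W: "leafwise (\<lambda>z. wmap z - s)" "\<psi> (\<lambda>z. wmap z - s) = 0"
    using leafwise_diff[OF leafwise_wmap leafwise_const, of s] psi_diff[OF leafwise_wmap leafwise_const, of s] w
    by (simp_all add: psi_const)
  have "\<psi> (\<lambda>z. of_real (u (wmap z)) * f (wmap z)) =
      \<psi> (\<lambda>z. of_real (u (wmap z)) + (of_real (u (wmap z)) * q (wmap z)) * (wmap z - s))"
    by (rule psi_cong) (simp add: fq algebra_simps)
  also have "\<dots> = 1"
    using psi_add[OF U leafwise_mult[OF H[OF hq] W(1)]] psi_mult[OF H[OF hq] W(1)] W(2) one[OF u(1,3)] by simp
  finally have uf: "\<psi> (\<lambda>z. of_real (u (wmap z)) * f (wmap z)) = 1" .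
  have "\<psi> (\<lambda>z. of_real (u (wmap z)) * f (wmap z)) =
      \<psi> (\<lambda>z. of_real (u (wmap z)) * f (wmap z) / (z $ j) ^ k * (z $ j) ^ k)"
  proof (rule psi_cong)
    fix z assume z: "z \<in> S3"
    show "of_real (u (wmap z)) * f (wmap z) = of_real (u (wmap z)) * f (wmap z) / (z $ j) ^ k * (z $ j) ^ k"
    proof (cases "u (wmap z) = 0")
      case False
      then have "wmap z \<in> V" using u(4) closure_subset[of "{x. u x \<noteq> 0}"] by blast
      then have "z $ j \<noteq> 0" using bary_wmap[OF z, of j] by (auto simp: V_def)
      then show ?thesis by simp
    qed simp
  qed
  also have "\<dots> = \<psi> (\<lambda>z. of_real (u (wmap z)) * f (wmap z) / (z $ j) ^ k) * \<psi> (\<lambda>z. z $ j) ^ k"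
    by (simp only: psi_mult[OF G leafwise_power[OF leafwise_nth]] psi_power[OF leafwise_nth])
  finally have "1 = \<psi> (\<lambda>z. of_real (u (wmap z)) * f (wmap z) / (z $ j) ^ k) * \<psi> (\<lambda>z. z $ j) ^ k"
    using uf by simp
  then have "cmod 1 = cmod (\<psi> (\<lambda>z. of_real (u (wmap z)) * f (wmap z) / (z $ j) ^ k) * \<psi> (\<lambda>z. z $ j) ^ k)"
    by (rule arg_cong)
  then have "1 = cmod (\<psi> (\<lambda>z. of_real (u (wmap z)) * f (wmap z) / (z $ j) ^ k)) * cmod (\<psi> (\<lambda>z. z $ j)) ^ k"
    by (simp only: norm_mult norm_one norm_power)
  also have "\<dots> \<le> L ^ k * cmod (\<psi> (\<lambda>z. z $ j)) ^ k"
    using psi_bound[OF G _ Gb] L(1) by (intro mult_right_mono) auto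
  finally have "1 \<le> (L * cmod (\<psi> (\<lambda>z. z $ j))) ^ k" by (simp add: power_mult_distrib)
  then have "\<not> (L * cmod (\<psi> (\<lambda>z. z $ j))) ^ k < 1" by simp
  moreover have "0 \<le> L * cmod (\<psi> (\<lambda>z. z $ j))" using L(1) by simp
  ultimately show ?thesis using k0 by (simp add: power_less_one_iff)
qed

lemma coordinate_bound:
  assumes "\<psi> wmap = s" "s \<in> E" "closed E" "saturated E" "(\<exists>n. E = Q n) \<or> E = {s}"
    "\<forall>u. Qconst u \<and> (\<forall>x\<in>E. u x = 1) \<longrightarrow> \<psi> (\<lambda>z. of_real (u (wmap z))) = 1"
  shows "bary j s \<le> (cmod (\<psi> (\<lambda>z. z $ j)))\<^sup>2"
proof (rule ccontr)
  assume neg: "\<not> ?thesis"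
  define c where "c = cmod (\<psi> (\<lambda>z. z $ j))"
  have c: "0 \<le> c" "c\<^sup>2 < bary j s" using neg by (auto simp: c_def)
  then have bs: "0 < bary j s" using zero_le_power2[of c] by linarith
  have J: "jensen_trivial E"
    using assms(5) Q_cheese jensen_trivial_singleton by (auto simp: cheese_def)
  have pos: "0 < bary j x" if "x \<in> E" for x
    using assms(5)
  proof
    assume "\<exists>n. E = Q n"
    then show ?thesis using that Q_tri by (force simp: open_triangle_def)
  qed (use that bs in auto)
  have cs: "c < sqrt (bary j s)" using c by (simp add: real_less_rsqrt)
  \<comment> \<open>The reciprocal of the midpoint of \<open>c\<close> and
    \<open>sqrt (bary j s)\<close>, so that \<open>L * c < 1 < L * sqrt (bary j s)\<close>.\<close>
  define L where "L = 2 / (sqrt (bary j s) + c)"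
  have sp: "sqrt (bary j s) + c > 0" using bs c by (simp add: add_pos_nonneg)
  have "0 < L" "1 < L * sqrt (bary j s)" "L * c < 1"
    using sp cs by (auto simp: L_def field_simps)
  then show False
    using jensen_bound[OF assms(2-4) J assms(1) _ pos, of L] assms(6) by (force simp: c_def)
qed

text \<open>The coordinate bounds give the vector \<open>c\<close> norm at least 1, and the linear
  function \<open>ip\<close> gives the reverse inequality. A peak function at \<open>c\<close> then
  shows that the character kills every function vanishing at \<open>c\<close>.\<close>

lemma evaluation: "\<exists>x\<in>S3. \<forall>f\<in>alg. \<phi> f = f x"
proof -
  obtain s E where sE: "s \<in> E" "closed E" "saturated E" "(\<exists>n. E = Q n) \<or> E = {s}" "\<psi> wmap = s"
     "\<forall>u. Qconst u \<and> (\<forall>x\<in>E. u x = 1) \<longrightarrow> \<psi> (\<lambda>z. of_real (u (wmap z))) = 1"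
    using leaf_point by blast
  define c :: "complex^3" where "c = (\<chi> j. \<psi> (\<lambda>z. z $ j))"
  have "(norm c)\<^sup>2 \<ge> bary 1 s + bary 2 s + bary 3 s"
    unfolding norm_sq_vec3 using coordinate_bound[OF sE(5,1-4,6)]
    by (simp add: c_def add_mono)
  then have c1: "(norm c)\<^sup>2 \<ge> 1" by (simp add: sum_bary)
  \<comment> \<open>Its value is \<open>(norm c)\<^sup>2\<close>, but on the sphere it is bounded by
    \<open>norm c\<close>; hence \<open>norm c \<le> 1\<close>.\<close>
  define ip where "ip z = (\<Sum>j\<in>UNIV. cnj (c $ j) * z $ j)" for z :: "complex^3"
  have lip: "leafwise ip"
    unfolding ip_def by (intro leafwise_sum leafwise_scale leafwise_nth) auto
  have psi_ip: "\<psi> ip = of_real ((norm c)\<^sup>2)"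
  proof -
    have "\<psi> ip = (\<Sum>j\<in>UNIV. cnj (c $ j) * c $ j)"
      unfolding ip_def by (subst psi_sum) (auto simp: c_def psi_scale leafwise_nth leafwise_scale)
    also have "\<dots> = of_real ((norm c)\<^sup>2)"
      by (simp add: norm_sq_vec3 sum_3 complex_norm_square mult.commute del: of_real_power)
    finally show ?thesis .
  qed
  have ip_le: "cmod (ip z) \<le> norm c * norm z" for z
  proof -
    have "cmod (ip z) \<le> (\<Sum>j\<in>UNIV. \<bar>cmod (c $ j)\<bar> * \<bar>cmod (z $ j)\<bar>)"
      unfolding ip_def by (rule order_trans[OF norm_sum]) (simp add: norm_mult)
    also have "\<dots> \<le> norm c * norm z"
      unfolding norm_vec_def by (rule L2_set_mult_ineq)
    finally show ?thesis .
  qed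
  have "(norm c)\<^sup>2 \<le> norm c"
  proof -
    have "cmod (ip z) \<le> norm c" if "z \<in> S3" for z using ip_le[of z] that by simp
    then have "cmod (\<psi> ip) \<le> norm c" by (rule psi_bound[OF lip norm_ge_zero])
    then show ?thesis unfolding psi_ip norm_of_real by simp
  qed
  then have "norm c \<le> 1" by (cases "norm c = 0") (auto simp: power2_eq_square)
  then have nc: "norm c = 1" using c1 by (smt (verit) norm_ge_zero power_le_one power2_eq_1_iff)
  then have cS: "c \<in> S3" by simp
  \<comment> \<open>A peak function: \<open>p c = 1\<close>, and its modulus is below 1 elsewhere on
    the sphere.\<close>
  define p where "p z = (1 / 2) * (1 + ip z)" for z
  have lp: "leafwise p" unfolding p_def by (intro leafwise_scale leafwise_add leafwise_const lip)
  have psip: "\<psi> p = 1"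
    unfolding p_def using psi_scale[OF leafwise_add[OF leafwise_const lip], of "1/2" 1]
      psi_add[OF leafwise_const lip, of 1] psi_const nc psi_ip by simp
  have pc: "(cmod (p z))\<^sup>2 \<le> 1 - (dist z c)\<^sup>2 / 4" if z: "z \<in> S3" for z
  proof -
    have "(norm (z - c))\<^sup>2 = (norm z)\<^sup>2 + (norm c)\<^sup>2 - 2 * Re (ip z)"
      unfolding norm_sq_vec3 ip_def sum_3
      by (simp add: cmod_power2) (simp add: power2_eq_square algebra_simps)
    then have re: "2 * Re (ip z) = 2 - (dist z c)\<^sup>2" using z nc by (simp add: dist_norm)
    have "(cmod (1 + ip z))\<^sup>2 = 1 + 2 * Re (ip z) + (cmod (ip z))\<^sup>2"
      by (simp add: cmod_power2) (simp add: power2_eq_square algebra_simps)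
    also have "\<dots> \<le> 1 + 2 * Re (ip z) + 1"
      using ip_le[of z] z nc by (simp add: power_le_one)
    finally show ?thesis unfolding p_def by (simp add: norm_mult norm_divide power_divide re)
  qed
  have p1: "cmod (p z) \<le> 1" if "z \<in> S3" for z
  proof (rule power2_le_imp_le[OF _ zero_le_one])
    show "(cmod (p z))\<^sup>2 \<le> 1\<^sup>2"
      using pc[OF that] zero_le_power2[of "dist z c"] unfolding power_one by linarith
  qed
  have zero: "\<psi> F = 0" if F: "leafwise F" "F c = 0" for F
  proof -
    have "cmod (\<psi> F) \<le> e" if e: "e > 0" for e
    proof -
      obtain d where d: "d > 0" "\<And>z. z \<in> S3 \<Longrightarrow> dist z c < d \<Longrightarrow> dist (F z) (F c) < e"
        using leafwise_continuous[OF F(1)] cS e unfolding continuous_on_iff by metis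
      obtain M where M: "M \<ge> 0" "\<forall>z\<in>S3. cmod (F z) \<le> M"
        using bounded_on_S3[OF leafwise_continuous[OF F(1)]] by blast
      \<comment> \<open>A bound for \<open>|p|\<close> at distance at least \<open>d\<close> from
        \<open>c\<close>; the maximum with 0 covers \<open>d > 2\<close>. As
        \<open>\<psi> p = 1\<close>, multiplying \<open>F\<close> by powers of \<open>p\<close> does
        not change its value.\<close>
      define q where "q = sqrt (max 0 (1 - d\<^sup>2 / 4))"
      have q: "0 \<le> q" "q < 1" using d(1) by (auto simp: q_def max_def real_sqrt_lt_1_iff)
      obtain k where k: "q ^ k < e / (M + 1)"
        using real_arch_pow_inv[of "e / (M + 1)" q] q(2) e M(1) by auto
      have "cmod (p z ^ k * F z) \<le> e" if z: "z \<in> S3" for z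
      proof (cases "dist z c < d")
        case True
        have "cmod (p z) ^ k * cmod (F z) \<le> 1 * e"
          using d(2)[OF z True] p1[OF z] F(2) by (intro mult_mono power_le_one) auto
        then show ?thesis by (simp add: norm_mult norm_power)
      next
        case False
        then have "d\<^sup>2 \<le> (dist z c)\<^sup>2" using d(1) by (intro power_mono) auto
        then have "(cmod (p z))\<^sup>2 \<le> max 0 (1 - d\<^sup>2 / 4)" using pc[OF z] by linarith
        then have "cmod (p z) \<le> q" unfolding q_def by (rule real_le_rsqrt)
        then have "cmod (p z) ^ k \<le> q ^ k" by (rule power_mono) simp
        then have "cmod (p z) ^ k \<le> e / (M + 1)" using k by linarith
        moreover have "cmod (F z) \<le> M" using M(2) z by blast
        moreover have "0 \<le> e / (M + 1)" using e M(1) by simp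
        ultimately have "cmod (p z) ^ k * cmod (F z) \<le> (e / (M + 1)) * M"
          by (intro mult_mono) simp_all
        also have "\<dots> \<le> e" using M(1) e by (simp add: field_simps)
        finally show ?thesis by (simp add: norm_mult norm_power)
      qed
      then have "cmod (\<psi> (\<lambda>z. p z ^ k * F z)) \<le> e"
        using e by (intro psi_bound leafwise_mult leafwise_power lp F(1)) auto
      then show ?thesis using psi_mult[OF leafwise_power[OF lp] F(1)] psi_power[OF lp] psip by simp
    qed
    then show ?thesis by (metis field_le_epsilon add_0 norm_le_zero_iff)
  qed
  have "\<phi> f = f c" if f: "f \<in> alg" for f
  proof -
    have fr: "restrict f S3 = f" "leafwise f" using f by (auto simp: alg_iff extensional_restrict)
    have "\<psi> (\<lambda>z. f z - f c) = 0"
      using leafwise_diff[OF fr(2) leafwise_const] by (intro zero) auto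
    then have "\<psi> f = f c" using psi_diff[OF fr(2) leafwise_const, of "f c"] psi_const by simp
    then show ?thesis using fr(1) by (simp add: \<psi>_def)
  qed
  then show ?thesis using cS by blast
qed

end

context cheese_family
begin

lemma natural_alg: "natural S3 alg"
  unfolding natural_def
proof (intro allI impI, elim conjE)
  fix \<phi> assume "mult_lin_functional S3 alg \<phi>" "\<exists>f\<in>alg. \<phi> f \<noteq> 0"
  then interpret alg_character Q \<phi> by unfold_locales
  show "\<exists>x\<in>S3. \<forall>f\<in>alg. \<phi> f = f x" by (rule evaluation)
qed

end

section \<open>Essentiality\<close>

lemma torus_act_add: "torus_act s (torus_act t z) = torus_act (s + t) z"
  by (simp add: vec_eq_iff cis_mult mult.assoc[symmetric])

lemma torus_act_zero: "torus_act 0 z = z"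
  by (simp add: vec_eq_iff)

lemma torus_act_sec:
  assumes "z \<in> S3"
  shows "\<exists>t. z = torus_act t (sec (wmap z))"
proof -
  have "z = torus_act (\<chi> j. Arg (z $ j)) (sec (wmap z))"
    using rcis_cmod_Arg bary_wmap[OF assms]
    by (simp add: vec_eq_iff sec_def rcis_def mult.commute)
  then show ?thesis by blast
qed

lemma continuous_on_sec: "continuous_on S sec"
  unfolding sec_def by (intro continuous_on_vec_lambda continuous_intros)

text \<open>A small step from \<open>w\<close> towards an interior point enters the open
  triangle.\<close>

lemma triangle_closure:
  assumes "w \<in> closed_triangle" "open U" "w \<in> U"
  shows "U \<inter> open_triangle \<noteq> {}"
proof -
  obtain v where v: "v \<in> open_triangle" using open_triangle_nonempty by blast
  obtain e where e: "e > 0" "ball w e \<subseteq> U" using assms(2,3) open_contains_ball by blast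
  define t where "t = min (1 / 2) (e / (2 * (dist w v + 1)))"
  have dp: "dist w v + 1 > 0" by (simp add: add_nonneg_pos)
  have t: "0 < t" "t < 1" using e dp by (auto simp: t_def min_def)
  define x where "x = w + t *\<^sub>R (v - w)"
  have "t * (dist w v + 1) \<le> e / 2"
  proof -
    have "t \<le> e / (2 * (dist w v + 1))" by (simp add: t_def)
    then show ?thesis using dp by (simp add: field_simps)
  qed
  moreover have "dist w x = t * dist w v" using t by (simp add: x_def dist_norm norm_minus_commute)
  ultimately have "dist w x < e" using t e by (simp add: algebra_simps)
  then have "x \<in> U" using e(2) by auto
  moreover have "x \<in> open_triangle"
  proof -
    have "bary j x = (1 - t) * bary j w + t * bary j v" for j
      by (simp add: bary_def x_def algebra_simps)
    then show ?thesis
      using assms(1) v t by (simp add: open_triangle_def closed_triangle_def add_nonneg_pos)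
  qed
  ultimately show ?thesis by blast
qed

text \<open>The distance function, except for the empty set, for which \<open>infdist\<close> is
  constantly 0.\<close>

lemma closed_zero_function:
  fixes F :: "'a::metric_space set"
  assumes "closed F"
  shows "\<exists>h :: 'a \<Rightarrow> real. continuous_on UNIV h \<and> (\<forall>z. 0 \<le> h z) \<and> (\<forall>z. h z = 0 \<longleftrightarrow> z \<in> F)"
proof (cases "F = {}")
  case True
  then show ?thesis by (intro exI[of _ "\<lambda>_. 1"]) auto
next
  case False
  then show ?thesis
    using assms by (intro exI[of _ "\<lambda>z. infdist z F"])
      (auto simp: infdist_nonneg in_closed_iff_infdist_zero intro!: continuous_intros)
qed

context cheese_family
begin

text \<open>An open set on which the algebra is unrestricted could be translated by the torus; finitely many
  translates cover a whole fibre set over some \<open>Q n\<close>, on which not everything is approximable.\<close>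

lemma vanishing_set_full:
  assumes F: "closed F" "F \<subseteq> S3" and van: "contains_vanishing S3 alg F"
  shows "S3 \<subseteq> F"
proof (rule ccontr)
  assume "\<not> S3 \<subseteq> F"
  then obtain x where x: "x \<in> S3" "x \<notin> F" by blast
  obtain t where t: "x = torus_act t (sec (wmap x))" using torus_act_sec[OF x(1)] by blast
  \<comment> \<open>Rotating the section by the fixed \<open>t\<close> gives a point outside
    \<open>F\<close> over each \<open>w\<close> in \<open>U\<close>. So every point over a cheese
    inside \<open>U\<close> can be rotated out of \<open>F\<close>.\<close>
  define U where "U = (\<lambda>w. torus_act t (sec w)) -` (- F)"
  have "continuous_on UNIV (\<lambda>w. torus_act t (sec w))"
    by (rule continuous_on_compose2[OF continuous_on_torus_act continuous_on_sec]) (rule subset_UNIV)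
  then have oU: "open U" unfolding U_def using F(1) by (intro open_vimage) auto
  have xU: "wmap x \<in> U" using t x(2) by (simp add: U_def)
  have "wmap x \<in> closed_triangle" using x(1) by (simp add: closed_triangle_def bary_wmap)
  from Q_dense[OF oU triangle_closure[OF this oU xU]]
  obtain n where n: "Q n \<subseteq> U" by (rule exE)
  obtain g e where g: "continuous_on UNIV g" "e > 0"
    "\<And>G. leaf_fun (Q n) G \<Longrightarrow> \<exists>z\<in>S3. wmap z \<in> Q n \<and> e \<le> cmod (g (wmap z) - G z)"
    using leaf_fun_not_approx[OF Q_cheese Q_tri] by metis
  obtain h :: "complex^3 \<Rightarrow> real" where h: "continuous_on UNIV h" "\<And>z. 0 \<le> h z" "\<And>z. h z = 0 \<longleftrightarrow> z \<in> F"
    using closed_zero_function[OF F(1)] by blast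
  define P where "P = S3 \<inter> wmap -` Q n"
  have cw: "continuous_on S wmap" for S by (intro continuous_intros)
  have P: "compact P"
    unfolding P_def by (intro compact_Int_closed compact_S3 closed_vimage Q_closed cw)
  have ch: "continuous_on S (\<lambda>z. h (torus_act b z))" for S b
    by (rule continuous_on_compose2[OF h(1) continuous_on_torus_act]) (rule subset_UNIV)
  have cover: "P \<subseteq> (\<Union>b\<in>UNIV. {z. 0 < h (torus_act b z)})"
  proof
    fix z assume z: "z \<in> P"
    obtain a where a: "z = torus_act a (sec (wmap z))" using torus_act_sec[of z] z by (auto simp: P_def)
    have "torus_act (t - a) z = torus_act t (sec (wmap z))"
      using a torus_act_add[of "t - a" a "sec (wmap z)"] by simp
    moreover have "torus_act t (sec (wmap z)) \<notin> F" using z n by (auto simp: P_def U_def)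
    ultimately have "h (torus_act (t - a) z) \<noteq> 0" using h(3) by simp
    then have "0 < h (torus_act (t - a) z)" using h(2)[of "torus_act (t - a) z"] by simp
    then show "z \<in> (\<Union>b\<in>UNIV. {z. 0 < h (torus_act b z)})" by blast
  qed
  obtain D where D: "D \<subseteq> UNIV" "finite D" "P \<subseteq> (\<Union>b\<in>D. {z. 0 < h (torus_act b z)})"
  proof (rule compactE_image[OF P _ cover])
    show "open {z. 0 < h (torus_act b z)}" for b by (intro open_Collect_less continuous_on_const ch)
  qed
  define H where "H z = (\<Sum>b\<in>D. h (torus_act b z))" for z
  have cH: "continuous_on S H" for S unfolding H_def by (intro continuous_on_sum ch)
  have Hpos: "H z > 0" if z: "z \<in> P" for z
  proof -
    obtain b where "b \<in> D" "0 < h (torus_act b z)" using D(3) z by blast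
    then show ?thesis unfolding H_def using D(2) h(2) by (intro sum_pos2[of D b]) auto
  qed
  have "P \<noteq> {}" using g(3)[OF leaf_fun_const[of _ 0]] by (auto simp: P_def)
  then obtain y where y: "y \<in> P" "\<forall>z\<in>P. H y \<le> H z"
    using continuous_attains_inf[OF P _ cH] by blast
  define m where "m = H y"
  have m: "m > 0" "\<And>z. z \<in> P \<Longrightarrow> m \<le> H z" using y Hpos by (auto simp: m_def)
  have mx: "max u m \<noteq> 0" for u using m(1) by (auto simp: max_def)
  \<comment> \<open>Each \<open>T b\<close> vanishes on \<open>F\<close>, so its restriction is in
    the algebra. The weights, after rotation by \<open>b\<close>, form a partition of unity over
    \<open>Q n\<close>, so the rotated functions add up to \<open>g (wmap z)\<close> there.\<close>
  define T where "T b z = g (wmap z) * of_real (h z / max (H (torus_act (- b) z)) m)" for b z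
  have T: "leafwise (T b)" for b
  proof -
    have "continuous_on S3 (\<lambda>z. g (wmap z))"
      by (rule continuous_on_compose2[OF g(1) cw]) (rule subset_UNIV)
    moreover have "continuous_on S3 (\<lambda>z. H (torus_act (- b) z))"
      by (rule continuous_on_compose2[OF cH[of UNIV] continuous_on_torus_act]) (rule subset_UNIV)
    moreover have "continuous_on S3 h" using h(1) continuous_on_subset by blast
    ultimately have "continuous_on S3 (T b)"
      unfolding T_def by (intro continuous_on_mult continuous_on_of_real continuous_on_divide
          continuous_on_max continuous_on_const) (auto simp: mx)
    then have "restrict (T b) S3 \<in> cont_funs S3"
      using continuous_on_cong[of S3 S3 "restrict (T b) S3" "T b"] by (simp add: cont_funs_def)
    moreover have "\<forall>z\<in>F. restrict (T b) S3 z = 0" using F(2) h(3) by (auto simp: T_def)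
    ultimately have "restrict (T b) S3 \<in> alg" using van unfolding contains_vanishing_def by blast
    then show ?thesis by (simp add: restrict_alg_iff)
  qed
  have "leafwise (\<lambda>z. \<Sum>b\<in>D. T b (torus_act b z))"
    using D(2) T by (intro leafwise_sum leafwise_torus_act)
  then obtain G where G: "leaf_fun (Q n) G"
      "\<And>z. z \<in> S3 \<Longrightarrow> wmap z \<in> Q n \<Longrightarrow> cmod ((\<Sum>b\<in>D. T b (torus_act b z)) - G z) < e"
    using g(2) unfolding leafwise_def by metis
  obtain z where z: "z \<in> S3" "wmap z \<in> Q n" "e \<le> cmod (g (wmap z) - G z)" using g(3)[OF G(1)] by blast
  have zP: "z \<in> P" using z by (simp add: P_def)
  have "(\<Sum>b\<in>D. T b (torus_act b z)) = (\<Sum>b\<in>D. g (wmap z) * of_real (h (torus_act b z) / max (H z) m))"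
    by (simp add: T_def torus_act_add torus_act_zero)
  also have "\<dots> = g (wmap z) * of_real (H z / max (H z) m)"
    by (simp add: H_def sum_distrib_left sum_divide_distrib)
  also have "H z / max (H z) m = 1" using m(2)[OF zP] Hpos[OF zP] by (simp add: max_def)
  finally show False using G(2)[OF z(1,2)] z(3) by simp
qed

lemma essential_alg: "essential S3 alg"
  unfolding essential_def is_essential_set_def
proof (intro conjI allI impI, goal_cases)
  case 1
  show ?case by simp
next
  case 2
  show ?case unfolding contains_vanishing_def
  proof (intro ballI impI)
    fix f :: "complex^3 \<Rightarrow> complex" assume f: "f \<in> cont_funs S3" "\<forall>x\<in>S3. f x = 0"
    have "leafwise f" by (rule leafwise_cong[OF leafwise_const[of 0]]) (use f in auto)
    then show "f \<in> alg" using f(1) by (simp add: alg_iff cont_funs_def)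
  qed
next
  case (3 F)
  then have "closed F" "F \<subseteq> S3"
    using closedin_closed_trans[of S3 F] closedin_subset[of "top_of_set S3" F] by auto
  then show ?case using vanishing_set_full 3 by blast
qed

end

theorem theorem1p6:
  "\<exists>A :: (complex^3 \<Rightarrow> complex) set.
     uniform_algebra unit_sphere3 A \<and> essential unit_sphere3 A \<and> natural unit_sphere3 A \<and>
     ball_algebra3 \<subseteq> A \<and> torus_invariant A"
proof -
  obtain Q :: "nat \<Rightarrow> complex set" where Q:
     "\<And>n. cheese (Q n) \<and> Q n \<subseteq> open_triangle \<and> (\<exists>p. Q n \<subseteq> cball p (inverse (real (Suc n))))"
     "\<And>m n. m \<noteq> n \<Longrightarrow> Q m \<inter> Q n = {}"
     "\<And>U. open U \<and> U \<inter> open_triangle \<noteq> {} \<Longrightarrow> \<exists>n. Q n \<subseteq> U"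
    using cheese_sequence by metis
  interpret cheese_family Q
    by unfold_locales (use Q in blast)+
  show ?thesis
    using uniform_algebra_alg essential_alg natural_alg ball_algebra_subset torus_invariant_alg by blast
qed

end
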